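(* For the $(N,K)$ cache network, when $\left\lceil \frac{K+1}{2}\right\rceil \le N \le K$, the exact rate-memory tradeoff is given by $$R^{*}(M)=\frac{KN-1}{K}-(N-1)M ,$$ where $M\in\left[\frac1K,\frac{N}{K(N-1)}\right]$.
   Context: Notation: $[L]=\{1,\dots,L\}$. $(N,K)$ cache network (with $1\le N\le K$): a server holds $N$ independent files $W_1,\dots,W_N$, each of size $F$ bits (uniformly distributed); there are $K$ users connected to the server by a common error-free link, and user $k$ has a cache. All sizes and entropies $H$ are measured in units of $F$ bits, so $H(W_1,\dots,W_N)=N$. Demands: $\boldsymbol{D}$ is the set of all surjective vectors $\boldsymbol{d}=(d_1,\dots,d_K)\in[N]^K$ (user $k$ requests file $W_{d_k}$, and every file is requested by at least one user). For a permutation $\pi$ of $[K]$, $\pi\boldsymbol{d}$ is the demand in which user $\pi(k)$ requests $W_{d_k}$, i.e. $(\pi\boldsymbol d)_k=d_{\pi^{-1}(k)}$. Caching scheme with cache size $M$: cache contents $Z_1,\dots,Z_K$, each a function of $(W_1,\dots,W_N)$ of size at most $M$ (so $H(Z_k)\le M$), chosen without knowledge of the demand, and for each $\boldsymbol d\in\boldsymbol D$ a broadcast $X_{\boldsymbol d}$, a function of $(W_1,\dots,W_N)$, of size $R_{\boldsymbol d}(M)$, such that for every $\boldsymbol d\in\boldsymbol D$ and $k\in[K]$ the file $W_{d_k}$ is a function of $(Z_k,X_{\boldsymbol d})$. The rate of the scheme is $R(M)=\max\{R_{\boldsymbol d}(M):\boldsymbol d\in\boldsymbol D\}$. Standing assumption: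 only symmetric schemes are considered, i.e. schemes whose joint entropies are unchanged under a permutation $\pi$ of the users, $H(W_{d_l},Z_{\pi(l)},X_{\pi\boldsymbol d})=H(W_{d_l},Z_l,X_{\boldsymbol d})$ for $l\in[K]$ and $\boldsymbol d\in\boldsymbol D$. The pair $(M,R)$ is achievable if there is a scheme with cache size $M$ and $R(M)\le R$. The exact rate-memory tradeoff is $R^*(M)=\min\{R: (M,R)\text{ is achievable}\}$, the smallest $R$ such that $(M,R)$ is achievable.
   Formalization: R*(M) is taken as the infimum of achievable R rather than the minimum, with attainment proved for every rational M; for irrational M no minimum exists, since finite files give rational cache sizes. N = 1, where N/(K(N-1)) is undefined, is vacuous. *)

theory Defs
  imports "HOL-Probability.Probability"
begin

type_synonym bits = "bool list"

type_synonym files = "nat \<Rightarrow> bits"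

type_synonym demand = "nat \<Rightarrow> nat"

definition file_space :: "nat \<Rightarrow> nat \<Rightarrow> files set" where
  "file_space N F = {1..N} \<rightarrow>\<^sub>E {b. length b = F}"

text \<open>Independent uniform files of \<open>F\<close> bits: the uniform distribution on all file tuples.\<close>

definition file_measure :: "nat \<Rightarrow> nat \<Rightarrow> files measure" where
  "file_measure N F = uniform_count_measure (file_space N F)"

text \<open>
  Shannon entropy, in units of \<open>F\<close> bits, of a function \<open>Y\<close> of the files; this is
  \<open>\<H>(Y)\<close> of \<open>information_space (file_measure N F) 2\<close> divided by \<open>F\<close>.
\<close>

definition entropyF :: "nat \<Rightarrow> nat \<Rightarrow> (files \<Rightarrow> 'b) \<Rightarrow> real" where
  "entropyF N F Y =
     prob_space.entropy (file_measure N F) 2 (count_space (Y ` space (file_measure N F))) Y / real F"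

definition demands :: "nat \<Rightarrow> nat \<Rightarrow> demand set" where
  "demands N K = {d \<in> {1..K} \<rightarrow>\<^sub>E {1..N}. d ` {1..K} = {1..N}}"

definition permute_demand :: "(nat \<Rightarrow> nat) \<Rightarrow> demand \<Rightarrow> demand" where
  "permute_demand \<pi> d = d \<circ> inv \<pi>"

lemma permute_demand_in_demands:
  assumes "\<pi> permutes {1..K}" "d \<in> demands N K"
  shows "permute_demand \<pi> d \<in> demands N K"
proof -
  have p: "inv \<pi> permutes {1..K}"
    using assms(1) by (rule permutes_inv)
  have im: "permute_demand \<pi> d ` {1..K} = {1..N}"
    using permutes_image[OF p] assms(2) unfolding permute_demand_def demands_def
    by (metis (mono_tags, lifting) image_comp mem_Collect_eq)
  have "permute_demand \<pi> d \<in> extensional {1..K}"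
    using assms(2) permutes_not_in[OF p]
    by (auto simp: permute_demand_def demands_def extensional_def PiE_def)
  with im show ?thesis
    unfolding demands_def PiE_def by blast
qed

text \<open>
  Cache \<open>Z k\<close> is a string of \<open>m k\<close> bits, and the broadcast \<open>X d\<close> for demand \<open>d\<close>
  a string of \<open>r d\<close> bits; both are functions of the files.  The lengths do not depend on the
  files, so that \<open>m k / F\<close> and \<open>r d / F\<close> bound the corresponding entropies.
\<close>

locale caching_scheme =
  fixes N K F :: nat
    and m :: "nat \<Rightarrow> nat" and r :: "demand \<Rightarrow> nat"
    and Z :: "nat \<Rightarrow> files \<Rightarrow> bits" and X :: "demand \<Rightarrow> files \<Rightarrow> bits"
  assumes file_size_pos: "0 < F"
    and cache_length:
      "\<And>k w. k \<in> {1..K} \<Longrightarrow> w \<in> file_space N F \<Longrightarrow> length (Z k w) = m k"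
    and broadcast_length:
      "\<And>d w. d \<in> demands N K \<Longrightarrow> w \<in> file_space N F \<Longrightarrow> length (X d w) = r d"
    and decodable:
      "\<And>d k. d \<in> demands N K \<Longrightarrow> k \<in> {1..K} \<Longrightarrow>
         \<exists>\<psi>. \<forall>w\<in>file_space N F. w (d k) = \<psi> (Z k w) (X d w)"

locale symmetric_caching_scheme = caching_scheme +
  assumes symmetric:
    "\<And>\<pi> d l. \<pi> permutes {1..K} \<Longrightarrow> d \<in> demands N K \<Longrightarrow> l \<in> {1..K} \<Longrightarrow>
       entropyF N F (\<lambda>w. (w (d l), Z (\<pi> l) w, X (permute_demand \<pi> d) w)) =
       entropyF N F (\<lambda>w. (w (d l), Z l w, X d w))"

definition scheme_rate :: "nat \<Rightarrow> nat \<Rightarrow> nat \<Rightarrow> (demand \<Rightarrow> nat) \<Rightarrow> real" where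
  "scheme_rate N K F r = Max ((\<lambda>d. real (r d) / real F) ` demands N K)"

text \<open>The file size \<open>F\<close> is free: a scheme may subdivide the files as finely as it needs.\<close>

definition achievable :: "nat \<Rightarrow> nat \<Rightarrow> real \<Rightarrow> real \<Rightarrow> bool" where
  "achievable N K M R \<longleftrightarrow>
     (\<exists>F m r Z X. symmetric_caching_scheme N K F m r Z X \<and>
        (\<forall>k\<in>{1..K}. real (m k) / real F \<le> M) \<and> scheme_rate N K F r \<le> R)"

text \<open>
  An infimum rather than a minimum: a scheme with finite files has rational cache sizes and rate,
  so where the tradeoff is strictly decreasing an irrational \<open>M\<close> is reached only in the limit of
  large \<open>F\<close>.
\<close>

definition optimal_rate :: "nat \<Rightarrow> nat \<Rightarrow> real \<Rightarrow> real" where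
  "optimal_rate N K M = Inf {R. achievable N K M R}"

lemma finite_file_space: "finite (file_space N F)"
proof -
  have "finite {b :: bits. length b = F}"
    using finite_lists_length_eq[of "UNIV :: bool set" F] by simp
  then show ?thesis
    unfolding file_space_def by (intro finite_PiE) auto
qed

lemma file_space_nonempty: "file_space N F \<noteq> {}"
proof -
  have "replicate F True \<in> {b. length b = F}" by simp
  then have "{b :: bits. length b = F} \<noteq> {}" by blast
  then show ?thesis
    unfolding file_space_def PiE_eq_empty_iff by blast
qed

lemma information_space_file_measure: "information_space (file_measure N F) 2"
proof -
  have "prob_space (file_measure N F)"
    unfolding file_measure_def
    using finite_file_space file_space_nonempty by (rule prob_space_uniform_count_measure)
  then show ?thesis
    by (simp add: information_space_def information_space_axioms_def)
qed

lemma finite_demands: "finite (demands N K)"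
proof -
  have "finite ({1..K} \<rightarrow>\<^sub>E {1..N})"
    by (intro finite_PiE) auto
  then show ?thesis
    by (rule rev_finite_subset) (auto simp: demands_def)
qed

lemma demands_nonempty:
  assumes "1 \<le> N" "N \<le> K"
  shows "demands N K \<noteq> {}"
proof -
  let ?d = "\<lambda>k\<in>{1..K}. min k N"
  have "{1..N} \<subseteq> ?d ` {1..K}"
  proof
    fix i assume "i \<in> {1..N}"
    then have "i = ?d i" "i \<in> {1..K}"
      using assms by auto
    then show "i \<in> ?d ` {1..K}" by (rule image_eqI)
  qed
  moreover have "?d ` {1..K} \<subseteq> {1..N}"
    using assms by auto
  ultimately have "?d \<in> demands N K"
    unfolding demands_def by (auto simp: PiE_def Pi_def)
  then show ?thesis by blast
qed

text \<open>The infimum is taken over a nonempty set that is bounded below.\<close>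

lemma achievable_nonneg:
  assumes "1 \<le> N" "N \<le> K" "achievable N K M R"
  shows "0 \<le> R"
proof -
  obtain d where d: "d \<in> demands N K"
    using demands_nonempty[OF assms(1,2)] by blast
  obtain F m r Z X where "scheme_rate N K F r \<le> R"
    using assms(3) unfolding achievable_def by blast
  moreover have "real (r d) / real F \<le> scheme_rate N K F r"
    unfolding scheme_rate_def using d finite_demands by (intro Max_ge) auto
  moreover have "0 \<le> real (r d) / real F" by simp
  ultimately show ?thesis by linarith
qed

lemma achievable_uncoded:
  assumes "1 \<le> N" "N \<le> K" "0 \<le> M"
  shows "achievable N K M (real N)"
proof -
  let ?X = "\<lambda>(d :: demand) w. map (\<lambda>i. hd (w i)) [1..<Suc N]"
  have "symmetric_caching_scheme N K 1 (\<lambda>_. 0) (\<lambda>_. N) (\<lambda>_ _. []) ?X"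
  proof
    fix d k assume "d \<in> demands N K" "k \<in> {1..K}"
    then have dk: "d k \<in> {1..N}" by (auto simp: demands_def)
    show "\<exists>\<psi>. \<forall>w\<in>file_space N 1. w (d k) = \<psi> ([] :: bits) (?X d w)"
    proof (intro exI ballI)
      fix w assume "w \<in> file_space N 1"
      with dk have "length (w (d k)) = 1" by (auto simp: file_space_def PiE_def Pi_def)
      then have "w (d k) = [hd (w (d k))]" by (cases "w (d k)") auto
      moreover have "?X d w ! (d k - 1) = hd (w (d k))"
        using dk by (subst nth_map) (auto simp: nth_upt simp del: upt_Suc)
      ultimately show "w (d k) = (\<lambda>_ x. [x ! (d k - 1)]) ([] :: bits) (?X d w)" by simp
    qed
  qed auto
  moreover have "scheme_rate N K 1 (\<lambda>_. N) \<le> real N"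
    unfolding scheme_rate_def using finite_demands demands_nonempty[OF assms(1,2)]
    by (intro Max.boundedI) auto
  ultimately show ?thesis
    unfolding achievable_def using assms(3) by fastforce
qed

end

theory Submission
  imports Defs "HOL-Library.Z2"
begin

text \<open>
  Lower bound.  Given \<open>W\<^sub>1, \<dots>, W\<^sub>N\<^sub>-\<^sub>1\<close>, let demands be chosen so that user \<open>i\<close> requests \<open>W\<^sub>N\<close> in
  \<open>X\<^sup>i\<close>.  Submodularity applied to \<open>(Z\<^sub>i, \<dots>, Z\<^sub>K)\<close> and \<open>(Z\<^sub>i\<^sub>+\<^sub>1, \<dots>, Z\<^sub>K, X\<^sup>i)\<close> yields a union that
  determines all files and the intersection \<open>(Z\<^sub>i\<^sub>+\<^sub>1, \<dots>, Z\<^sub>K)\<close>, so that telescoping over \<open>i\<close> gives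
  \<open>(\<Sum>i. H(W\<^sub>1, \<dots>, W\<^sub>N\<^sub>-\<^sub>1, Z\<^sub>i\<^sub>+\<^sub>1, \<dots>, Z\<^sub>K, X\<^sup>i)) \<ge> K N - 1\<close>.  On the other hand \<open>N - 1\<close> caches that
  recover \<open>W\<^sub>1, \<dots>, W\<^sub>N\<^sub>-\<^sub>1\<close> from \<open>X\<close> cost at most \<open>(N - 1) M + R\<close>, and two such groups of users with
  the same \<open>X\<close> can be uncrossed into windows of \<open>a\<close> and \<open>K - 1 - a\<close> consecutive users; this needs
  the \<open>K - 1\<close> users not requesting \<open>W\<^sub>N\<close> to split into two such groups, that is
  \<open>K - 1 \<le> 2 (N - 1)\<close>.  All demands used are cyclic shifts of one demand, so averaging over the shifts
  pairs the \<open>i\<close>-th term of the sum with the \<open>(K + 1 - i)\<close>-th.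

  Achievability.  Memory sharing between two linear schemes over the field with two elements, for the
  corner points \<open>M = 1 / K\<close> and \<open>M = N / (K (N - 1))\<close>.  Running one copy for each
  permutation of the users makes any scheme symmetric.
\<close>

section \<open>Entropy of functions of the files\<close>

lemma simple_function_file: "simple_function (file_measure N F) Y"
  by (auto simp: simple_function_def file_measure_def uniform_count_measure_def space_point_measure
      sets_point_measure finite_file_space)

lemma space_file_measure: "space (file_measure N F) = file_space N F"
  by (simp add: file_measure_def space_uniform_count_measure)

text \<open>Grouping the file tuples by the value of \<open>Y\<close> turns the entropy into an
  average over tuples of the log-proportion of their fiber. Only the fibers of \<open>Y\<close>
  enter, so different types of values can be compared.\<close>

lemma entropyF_eq_sum:
  "entropyF N F Y =
     - (\<Sum>w\<in>file_space N F. log 2 (card {w' \<in> file_space N F. Y w' = Y w} / card (file_space N F))) /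
       (real (card (file_space N F)) * real F)"
proof -
  let ?\<Omega> = "file_space N F"
  interpret information_space "file_measure N F" 2
    by (rule information_space_file_measure)
  have pr: "prob (Y -` {y} \<inter> space (file_measure N F)) =
      card {w' \<in> ?\<Omega>. Y w' = y} / card ?\<Omega>" for y
    unfolding space_file_measure file_measure_def
    by (subst measure_uniform_count_measure[OF finite_file_space])
      (auto simp: space_uniform_count_measure intro!: arg_cong[where f = card])
  have "entropy_Pow Y = - (\<Sum>y\<in>Y ` ?\<Omega>. card {w' \<in> ?\<Omega>. Y w' = y} / card ?\<Omega> *
      log 2 (card {w' \<in> ?\<Omega>. Y w' = y} / card ?\<Omega>))"
    using entropy_simple_distributed[OF simple_distributedI[OF simple_function_file measure_nonneg refl], of Y]
    by (simp add: pr) (simp add: space_file_measure)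
  also have "(\<Sum>y\<in>Y ` ?\<Omega>. card {w' \<in> ?\<Omega>. Y w' = y} / card ?\<Omega> *
      log 2 (card {w' \<in> ?\<Omega>. Y w' = y} / card ?\<Omega>)) =
      (\<Sum>y\<in>Y ` ?\<Omega>. \<Sum>w | w \<in> ?\<Omega> \<and> Y w = y.
        log 2 (card {w' \<in> ?\<Omega>. Y w' = Y w} / card ?\<Omega>) / card ?\<Omega>)"
    by (intro sum.cong refl) simp
  also have "\<dots> = (\<Sum>w\<in>?\<Omega>. log 2 (card {w' \<in> ?\<Omega>. Y w' = Y w} / card ?\<Omega>) / card ?\<Omega>)"
    by (rule sum.image_gen[symmetric, OF finite_file_space])
  finally show ?thesis
    by (simp add: entropyF_def space_file_measure sum_divide_distrib[symmetric])
qed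

text \<open>The bijection maps each fiber of \<open>Y'\<close> onto a fiber of \<open>Y\<close>, so
  fiber sizes agree. This is the tool for proving a scheme symmetric: a user permutation is matched
  by a rearrangement of the file bits.\<close>

lemma entropyF_bij_cong:
  assumes \<phi>: "bij_betw \<phi> (file_space N F) (file_space N F)"
    and ker: "\<And>w w'. w \<in> file_space N F \<Longrightarrow> w' \<in> file_space N F \<Longrightarrow>
      Y (\<phi> w) = Y (\<phi> w') \<longleftrightarrow> Y' w = Y' w'"
  shows "entropyF N F Y = entropyF N F Y'"
proof -
  let ?\<Omega> = "file_space N F"
  have "card {w' \<in> ?\<Omega>. Y w' = Y (\<phi> w)} = card {w' \<in> ?\<Omega>. Y' w' = Y' w}" if "w \<in> ?\<Omega>" for w
  proof -
    have "\<phi> ` {w' \<in> ?\<Omega>. Y' w' = Y' w} = {w' \<in> ?\<Omega>. Y w' = Y (\<phi> w)}"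
    proof (intro equalityI subsetI)
      fix v assume "v \<in> {w' \<in> ?\<Omega>. Y w' = Y (\<phi> w)}"
      moreover from this obtain w' where "w' \<in> ?\<Omega>" "v = \<phi> w'"
        using bij_betw_imp_surj_on[OF \<phi>] by blast
      ultimately show "v \<in> \<phi> ` {w' \<in> ?\<Omega>. Y' w' = Y' w}"
        using ker[OF _ that] by blast
    next
      fix v assume "v \<in> \<phi> ` {w' \<in> ?\<Omega>. Y' w' = Y' w}"
      then show "v \<in> {w' \<in> ?\<Omega>. Y w' = Y (\<phi> w)}"
        using ker[OF _ that] bij_betw_imp_surj_on[OF \<phi>] by blast
    qed
    moreover have "inj_on \<phi> {w' \<in> ?\<Omega>. Y' w' = Y' w}"
      using bij_betw_imp_inj_on[OF \<phi>] by (rule inj_on_subset) auto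
    ultimately show ?thesis
      using card_image by fastforce
  qed
  then have "(\<Sum>w\<in>?\<Omega>. log 2 (card {w' \<in> ?\<Omega>. Y w' = Y w} / card ?\<Omega>)) =
      (\<Sum>w\<in>?\<Omega>. log 2 (card {w' \<in> ?\<Omega>. Y' w' = Y' w} / card ?\<Omega>))"
    by (subst sum.reindex_bij_betw[OF \<phi>, symmetric]) simp
  then show ?thesis
    by (simp only: entropyF_eq_sum)
qed

text \<open>If \<open>Y\<close> determines \<open>Y'\<close>, each fiber of \<open>Y\<close> lies
  inside a fiber of \<open>Y'\<close>.\<close>

lemma entropyF_mono:
  assumes "\<And>w w'. w \<in> file_space N F \<Longrightarrow> w' \<in> file_space N F \<Longrightarrow> Y w = Y w' \<Longrightarrow> Y' w = Y' w'"
  shows "entropyF N F Y' \<le> entropyF N F Y"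
proof -
  let ?\<Omega> = "file_space N F"
  have "(\<Sum>w\<in>?\<Omega>. log 2 (card {w' \<in> ?\<Omega>. Y w' = Y w} / card ?\<Omega>)) \<le>
      (\<Sum>w\<in>?\<Omega>. log 2 (card {w' \<in> ?\<Omega>. Y' w' = Y' w} / card ?\<Omega>))"
  proof (rule sum_mono)
    fix w assume w: "w \<in> ?\<Omega>"
    have "card {w' \<in> ?\<Omega>. Y w' = Y w} \<le> card {w' \<in> ?\<Omega>. Y' w' = Y' w}"
      using w by (intro card_mono) (auto simp: finite_file_space intro: assms)
    moreover have "0 < card {w' \<in> ?\<Omega>. Y w' = Y w}"
      using w by (auto simp: card_gt_0_iff finite_file_space)
    moreover have "0 < card ?\<Omega>"
      by (simp add: card_gt_0_iff finite_file_space file_space_nonempty)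
    ultimately show "log 2 (card {w' \<in> ?\<Omega>. Y w' = Y w} / card ?\<Omega>) \<le>
        log 2 (card {w' \<in> ?\<Omega>. Y' w' = Y' w} / card ?\<Omega>)"
      by (intro log_mono) (auto intro: divide_right_mono)
  qed
  then show ?thesis
    unfolding entropyF_eq_sum by (intro divide_right_mono) auto
qed

text \<open>Counting core of the nonnegativity of conditional mutual information. The numerator
  counts pairs \<open>u\<close>, \<open>v\<close> with \<open>u\<close> in \<open>xz w\<close> and
  \<open>v\<close> in \<open>yz w\<close>. For a fixed pair, the fitting \<open>w\<close> are either
  none or one full class \<open>xyz w\<close>, so they contribute at most
  \<open>1 / card (z u)\<close>, and only if \<open>v\<close> lies in \<open>z u\<close>; summing
  over \<open>v\<close> gives at most 1 for each \<open>u\<close>.\<close>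

lemma sum_fiber_ratio_le:
  fixes X :: "'a \<Rightarrow> 'b" and Y :: "'a \<Rightarrow> 'c" and Z :: "'a \<Rightarrow> 'd"
  assumes fin: "finite A"
  defines "xz w \<equiv> {w' \<in> A. X w' = X w \<and> Z w' = Z w}"
    and "yz w \<equiv> {w' \<in> A. Y w' = Y w \<and> Z w' = Z w}"
    and "xyz w \<equiv> {w' \<in> A. X w' = X w \<and> Y w' = Y w \<and> Z w' = Z w}"
    and "z w \<equiv> {w' \<in> A. Z w' = Z w}"
  shows "(\<Sum>w\<in>A. real (card (xz w)) * card (yz w) / (card (xyz w) * card (z w))) \<le> card A"
proof -
  define t where "t u v = {w \<in> A. u \<in> xz w \<and> v \<in> yz w}" for u v
  have tz: "(\<Sum>w\<in>t u v. 1 / (card (xyz w) * card (z w))) \<le> (if v \<in> z u then 1 / card (z u) else 0)"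
    if "u \<in> A" "v \<in> A" for u v
  proof (cases "t u v = {}")
    case False
    then have vz: "v \<in> z u"
      using that by (auto simp: t_def xz_def yz_def z_def)
    have fint: "finite (t u v)"
      using fin by (simp add: t_def)
    have "xyz w = t u v \<and> z w = z u" if "w \<in> t u v" for w
      using that \<open>u \<in> A\<close> \<open>v \<in> A\<close> by (auto simp: t_def xyz_def xz_def yz_def z_def)
    then have "(\<Sum>w\<in>t u v. 1 / (card (xyz w) * card (z w))) = (\<Sum>w\<in>t u v. 1 / (card (t u v) * card (z u)))"
      by (intro sum.cong) auto
    also have "\<dots> = 1 / card (z u)"
      using False fint by simp
    finally show ?thesis
      using vz by simp
  qed auto
  have "(\<Sum>w\<in>A. real (card (xz w)) * card (yz w) / (card (xyz w) * card (z w))) =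
      (\<Sum>w\<in>A. \<Sum>u | u \<in> A \<and> u \<in> xz w. \<Sum>v | v \<in> A \<and> v \<in> yz w. 1 / (card (xyz w) * card (z w)))"
  proof (intro sum.cong refl)
    fix w
    have "{u. u \<in> A \<and> u \<in> xz w} = xz w" "{v. v \<in> A \<and> v \<in> yz w} = yz w"
      by (auto simp: xz_def yz_def)
    then show "real (card (xz w)) * card (yz w) / (card (xyz w) * card (z w)) =
        (\<Sum>u | u \<in> A \<and> u \<in> xz w. \<Sum>v | v \<in> A \<and> v \<in> yz w. 1 / (card (xyz w) * card (z w)))"
      by simp
  qed
  also have "\<dots> = (\<Sum>u\<in>A. \<Sum>w | w \<in> A \<and> u \<in> xz w. \<Sum>v | v \<in> A \<and> v \<in> yz w. 1 / (card (xyz w) * card (z w)))"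
    by (rule sum.swap_restrict[OF fin fin])
  also have "\<dots> = (\<Sum>u\<in>A. \<Sum>v\<in>A. \<Sum>w\<in>t u v. 1 / (card (xyz w) * card (z w)))"
  proof (rule sum.cong[OF refl])
    fix u
    have "(\<Sum>w | w \<in> A \<and> u \<in> xz w. \<Sum>v | v \<in> A \<and> v \<in> yz w. 1 / real (card (xyz w) * card (z w))) =
        (\<Sum>v\<in>A. \<Sum>w | w \<in> {w \<in> A. u \<in> xz w} \<and> v \<in> yz w. 1 / (card (xyz w) * card (z w)))"
      using fin by (intro sum.swap_restrict) auto
    then show "(\<Sum>w | w \<in> A \<and> u \<in> xz w. \<Sum>v | v \<in> A \<and> v \<in> yz w. 1 / (card (xyz w) * card (z w))) =
        (\<Sum>v\<in>A. \<Sum>w\<in>t u v. 1 / (card (xyz w) * card (z w)))"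
      by (simp add: t_def conj_assoc)
  qed
  also have "\<dots> \<le> (\<Sum>u\<in>A. \<Sum>v\<in>A. if v \<in> z u then 1 / card (z u) else 0)"
    by (intro sum_mono tz)
  also have "\<dots> = (\<Sum>u\<in>A. 1)"
  proof (rule sum.cong[OF refl])
    fix u assume "u \<in> A"
    then have "A \<inter> z u = z u" "finite (z u)" "z u \<noteq> {}"
      using fin by (auto simp: z_def)
    then show "(\<Sum>v\<in>A. if v \<in> z u then 1 / real (card (z u)) else 0) = 1"
      by (simp add: sum.If_cases[OF fin])
  qed
  finally show ?thesis
    by simp
qed

lemma entropyF_submodular:
  "entropyF N F (\<lambda>w. (X w, Y w, Z w)) + entropyF N F Z \<le>
     entropyF N F (\<lambda>w. (X w, Z w)) + entropyF N F (\<lambda>w. (Y w, Z w))"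
proof -
  let ?\<Omega> = "file_space N F"
  let ?n = "real (card ?\<Omega>)"
  define xz where "xz w = real (card {w' \<in> ?\<Omega>. X w' = X w \<and> Z w' = Z w})" for w
  define yz where "yz w = real (card {w' \<in> ?\<Omega>. Y w' = Y w \<and> Z w' = Z w})" for w
  define xyz where "xyz w = real (card {w' \<in> ?\<Omega>. X w' = X w \<and> Y w' = Y w \<and> Z w' = Z w})" for w
  define z where "z w = real (card {w' \<in> ?\<Omega>. Z w' = Z w})" for w
  have n: "0 < ?n"
    by (simp add: card_gt_0_iff finite_file_space file_space_nonempty)
  have "log 2 (xz w / ?n) + log 2 (yz w / ?n) \<le>
      log 2 (xyz w / ?n) + log 2 (z w / ?n) + (xz w * yz w / (xyz w * z w) - 1) / ln 2"
    if "w \<in> ?\<Omega>" for w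
  proof -
    have pos: "0 < xz w" "0 < yz w" "0 < xyz w" "0 < z w"
      using that by (auto simp: xz_def yz_def xyz_def z_def card_gt_0_iff finite_file_space)
    then have "log 2 (xz w / ?n) + log 2 (yz w / ?n) - log 2 (xyz w / ?n) - log 2 (z w / ?n) =
        ln (xz w * yz w / (xyz w * z w)) / ln 2"
      using n by (simp add: log_def ln_div ln_mult add_divide_distrib diff_divide_distrib)
    \<comment> \<open>The inequality \<open>ln t \<le> t - 1\<close> takes the place of Jensen's
      inequality; the sum of the right-hand sides is at most 0 by
      \<open>sum_fiber_ratio_le\<close>.\<close>
    also have "\<dots> \<le> (xz w * yz w / (xyz w * z w) - 1) / ln 2"
      using pos by (intro divide_right_mono ln_le_minus_one) auto
    finally show ?thesis
      by linarith
  qed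
  then have "(\<Sum>w\<in>?\<Omega>. log 2 (xz w / ?n) + log 2 (yz w / ?n)) \<le>
      (\<Sum>w\<in>?\<Omega>. log 2 (xyz w / ?n) + log 2 (z w / ?n) + (xz w * yz w / (xyz w * z w) - 1) / ln 2)"
    by (rule sum_mono)
  also have "\<dots> = (\<Sum>w\<in>?\<Omega>. log 2 (xyz w / ?n)) + (\<Sum>w\<in>?\<Omega>. log 2 (z w / ?n)) +
      ((\<Sum>w\<in>?\<Omega>. xz w * yz w / (xyz w * z w)) - ?n) / ln 2"
    by (simp add: sum.distrib sum_subtractf sum_divide_distrib[symmetric])
  also have "((\<Sum>w\<in>?\<Omega>. xz w * yz w / (xyz w * z w)) - ?n) / ln 2 \<le> 0"
    using sum_fiber_ratio_le[OF finite_file_space, of N F X Z Y]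
    by (intro divide_nonpos_pos) (simp_all add: xz_def yz_def xyz_def z_def)
  finally have "(\<Sum>w\<in>?\<Omega>. log 2 (xz w / ?n)) + (\<Sum>w\<in>?\<Omega>. log 2 (yz w / ?n)) \<le>
      (\<Sum>w\<in>?\<Omega>. log 2 (xyz w / ?n)) + (\<Sum>w\<in>?\<Omega>. log 2 (z w / ?n))"
    by (simp add: sum.distrib)
  then have "(- (\<Sum>w\<in>?\<Omega>. log 2 (xyz w / ?n)) + - (\<Sum>w\<in>?\<Omega>. log 2 (z w / ?n))) / (?n * real F) \<le>
      (- (\<Sum>w\<in>?\<Omega>. log 2 (xz w / ?n)) + - (\<Sum>w\<in>?\<Omega>. log 2 (yz w / ?n))) / (?n * real F)"
    by (intro divide_right_mono) auto
  then show ?thesis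
    unfolding entropyF_eq_sum add_divide_distrib[symmetric]
    by (simp add: xz_def yz_def xyz_def z_def)
qed

text \<open>A string of \<open>n\<close> bits takes at most \<open>2 ^ n\<close> values, and entropy
  is at most the logarithm of the number of values.\<close>

lemma entropyF_le_length:
  assumes "\<And>w. w \<in> file_space N F \<Longrightarrow> length (Y w) = n"
  shows "entropyF N F (Y :: files \<Rightarrow> bits) \<le> real n / real F"
proof -
  interpret information_space "file_measure N F" 2
    by (rule information_space_file_measure)
  have sub: "Y ` file_space N F \<subseteq> {b. length b = n}"
    using assms by auto
  have "card (Y ` file_space N F) \<le> card {b :: bits. set b \<subseteq> UNIV \<and> length b = n}"
    using sub finite_lists_length_eq[of "UNIV :: bool set" n] by (intro card_mono) auto
  also have "\<dots> = 2 ^ n"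
    by (subst card_lists_length_eq) auto
  finally have le: "card (Y ` file_space N F) \<le> 2 ^ n" .
  have "entropy_Pow Y \<le> log 2 (real (card (Y ` space (file_measure N F))))"
    using entropy_le_card[OF simple_distributedI[OF simple_function_file measure_nonneg refl]] .
  also have "\<dots> \<le> log 2 (2 ^ n)"
  proof (rule log_mono)
    show "0 < real (card (Y ` space (file_measure N F)))"
      by (auto simp: space_file_measure card_gt_0_iff finite_file_space file_space_nonempty)
    show "real (card (Y ` space (file_measure N F))) \<le> 2 ^ n"
      using of_nat_mono[OF le, where 'a = real] by (simp add: space_file_measure)
  qed simp
  finally show ?thesis
    unfolding entropyF_def by (simp add: divide_right_mono)
qed

lemma card_file_space: "card (file_space N F) = 2 ^ (N * F)"
proof -
  have "card {b :: bits. length b = F} = 2 ^ F"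
    using card_lists_length_eq[of "UNIV :: bool set" F] by simp
  then show ?thesis
    by (simp add: file_space_def card_PiE power_mult[symmetric] mult.commute)
qed

lemma card_file_fiber:
  assumes "n \<le> N" "w \<in> file_space N F"
  shows "card {w' \<in> file_space N F. \<forall>i\<in>{1..n}. w' i = w i} = 2 ^ ((N - n) * F)"
proof -
  have "{w' \<in> file_space N F. \<forall>i\<in>{1..n}. w' i = w i} =
      (\<Pi>\<^sub>E i\<in>{1..N}. if i \<le> n then {w i} else {b. length b = F})"
    using assms unfolding file_space_def
    by (auto simp: PiE_iff extensional_def split: if_splits)
  moreover have "card \<dots> = (\<Prod>i\<in>{1..N}. if i \<le> n then 1 else 2 ^ F)"
    using card_lists_length_eq[of "UNIV :: bool set" F]
    by (subst card_PiE) (auto intro!: prod.cong)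
  moreover have "\<dots> = (\<Prod>i\<in>{n+1..N}. 2 ^ F)"
    by (rule prod.mono_neutral_cong_right) auto
  ultimately show ?thesis
    by (simp add: power_mult[symmetric] mult.commute)
qed

text \<open>All fibers have the same size \<open>2 ^ ((N - n) * F)\<close>, so the average of the
  logarithms is a single constant.\<close>

lemma entropyF_files:
  assumes "n \<le> N" "0 < F"
    and ker: "\<And>w w'. w \<in> file_space N F \<Longrightarrow> w' \<in> file_space N F \<Longrightarrow>
      Y w = Y w' \<longleftrightarrow> (\<forall>i\<in>{1..n}. w i = w' i)"
  shows "entropyF N F Y = real n"
proof -
  have "log 2 (card {w' \<in> file_space N F. Y w' = Y w} / card (file_space N F)) = - (real n * real F)"
    if w: "w \<in> file_space N F" for w
  proof -
    have "{w' \<in> file_space N F. Y w' = Y w} = {w' \<in> file_space N F. \<forall>i\<in>{1..n}. w' i = w i}"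
      using ker[OF _ w] by auto
    then have "card {w' \<in> file_space N F. Y w' = Y w} = 2 ^ ((N - n) * F)"
      using card_file_fiber[OF assms(1) w] by simp
    then have "log 2 (card {w' \<in> file_space N F. Y w' = Y w} / card (file_space N F)) =
        real ((N - n) * F) - real (N * F)"
      by (simp add: card_file_space log_divide log_nat_power)
    then show ?thesis
      using assms(1) by (simp add: of_nat_diff algebra_simps)
  qed
  then show ?thesis
    using assms(2) by (simp add: entropyF_eq_sum card_file_space)
qed

section \<open>Lower bound on the rate\<close>

datatype var = File nat | Cache nat | Cast demand

context caching_scheme
begin

definition val :: "var \<Rightarrow> files \<Rightarrow> bits" where
  "val v w = (case v of File n \<Rightarrow> w n | Cache k \<Rightarrow> Z k w | Cast d \<Rightarrow> X d w)"

text \<open>Restricted functions act as tuples indexed by names of variables, so that sets of any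
  size share one type and submodularity can be phrased with unions and intersections.\<close>

definition H :: "var set \<Rightarrow> real" where
  "H S = entropyF N F (\<lambda>w. \<lambda>v\<in>S. val v w)"

lemma val_simps [simp]:
  "val (File n) w = w n" "val (Cache k) w = Z k w" "val (Cast d) w = X d w"
  by (simp_all add: val_def)

lemma restrict_val_eq_iff: "(\<lambda>v\<in>S. val v w) = (\<lambda>v\<in>S. val v w') \<longleftrightarrow> (\<forall>v\<in>S. val v w = val v w')"
  by (auto simp: fun_eq_iff)

lemma H_le_if_determined:
  assumes "\<And>w w' v. w \<in> file_space N F \<Longrightarrow> w' \<in> file_space N F \<Longrightarrow>
    (\<And>u. u \<in> S \<Longrightarrow> val u w = val u w') \<Longrightarrow> v \<in> T \<Longrightarrow> val v w = val v w'"
  shows "H T \<le> H S"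
  unfolding H_def by (rule entropyF_mono) (unfold restrict_val_eq_iff, blast intro: assms)

lemma H_mono: "S \<subseteq> T \<Longrightarrow> H S \<le> H T"
  by (rule H_le_if_determined) auto

lemma H_submodular: "H (S \<union> T) + H (S \<inter> T) \<le> H S + H T"
proof -
  let ?Y = "\<lambda>S w. \<lambda>v\<in>S. val v w"
  have "entropyF N F (\<lambda>w. (?Y S w, ?Y T w, ?Y (S \<inter> T) w)) + H (S \<inter> T) \<le>
      entropyF N F (\<lambda>w. (?Y S w, ?Y (S \<inter> T) w)) + entropyF N F (\<lambda>w. (?Y T w, ?Y (S \<inter> T) w))"
    unfolding H_def by (rule entropyF_submodular)
  moreover have "H (S \<union> T) \<le> entropyF N F (\<lambda>w. (?Y S w, ?Y T w, ?Y (S \<inter> T) w))"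
    unfolding H_def by (rule entropyF_mono) (auto simp: restrict_val_eq_iff)
  moreover have "entropyF N F (\<lambda>w. (?Y S w, ?Y (S \<inter> T) w)) \<le> H S"
    "entropyF N F (\<lambda>w. (?Y T w, ?Y (S \<inter> T) w)) \<le> H T"
    unfolding H_def by (rule entropyF_mono; auto simp: restrict_val_eq_iff)+
  ultimately show ?thesis
    by linarith
qed

lemma H_files: "n \<le> N \<Longrightarrow> H (File ` {1..n}) = real n"
  unfolding H_def using file_size_pos
  by (intro entropyF_files) (auto simp: restrict_val_eq_iff)

lemma H_le_N: "H S \<le> real N"
proof -
  have "H S \<le> H (File ` {1..N})"
  proof (rule H_le_if_determined)
    fix w w' v
    assume "w \<in> file_space N F" "w' \<in> file_space N F"
      "\<And>u. u \<in> File ` {1..N} \<Longrightarrow> val u w = val u w'"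
    then have "w = w'"
      unfolding file_space_def by (intro PiE_ext) force+
    then show "val v w = val v w'"
      by simp
  qed
  then show ?thesis
    using H_files[of N] by simp
qed

lemma H_empty: "H {} = 0"
  using H_files[of 0] by simp

lemma decode:
  assumes "d \<in> demands N K" "k \<in> {1..K}" "w \<in> file_space N F" "w' \<in> file_space N F"
    "Z k w = Z k w'" "X d w = X d w'"
  shows "w (d k) = w' (d k)"
  using decodable[OF assms(1,2)] assms(3-6) by metis

text \<open>Here \<open>k\<close> is a set of users. Their caches together with the broadcast
  determine the files they request, so adjoining these files does not raise the entropy.\<close>

lemma H_decode:
  assumes d: "d \<in> demands N K" and k: "Cache ` k \<subseteq> S" "k \<subseteq> {1..K}" and "Cast d \<in> S"
    and T: "T \<subseteq> S \<union> File ` d ` k"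
  shows "H T \<le> H S"
proof (rule H_le_if_determined)
  fix w w' v
  assume w: "w \<in> file_space N F" "w' \<in> file_space N F"
    and eq: "\<And>u. u \<in> S \<Longrightarrow> val u w = val u w'" and v: "v \<in> T"
  show "val v w = val v w'"
  proof (cases "v \<in> S")
    case False
    then obtain j where j: "j \<in> k" "v = File (d j)"
      using T v by blast
    then have "w (d j) = w' (d j)"
      using decode[OF d _ w, of j] eq[of "Cache j"] eq[of "Cast d"] assms by force
    then show ?thesis
      using j by simp
  qed (rule eq)
qed

lemma H_insert: "H (insert v S) \<le> H S + H {v}"
proof -
  have "0 \<le> H (S \<inter> {v})"
    using H_mono[of "{}" "S \<inter> {v}"] by (simp add: H_empty)
  then show ?thesis
    using H_submodular[of S "{v}"] by simp
qed

lemma H_cache: "k \<in> {1..K} \<Longrightarrow> H {Cache k} \<le> real (m k) / real F"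
proof -
  assume k: "k \<in> {1..K}"
  have "H {Cache k} \<le> entropyF N F (Z k)"
    unfolding H_def by (rule entropyF_mono) (simp add: restrict_val_eq_iff)
  then show ?thesis
    using entropyF_le_length[of N F "Z k" "m k"] cache_length[OF k] by fastforce
qed

lemma H_cast: "d \<in> demands N K \<Longrightarrow> H {Cast d} \<le> real (r d) / real F"
proof -
  assume d: "d \<in> demands N K"
  have "H {Cast d} \<le> entropyF N F (X d)"
    unfolding H_def by (rule entropyF_mono) (simp add: restrict_val_eq_iff)
  then show ?thesis
    using entropyF_le_length[of N F "X d" "r d"] broadcast_length[OF d] by fastforce
qed

lemma H_caches_cast:
  assumes d: "d \<in> demands N K" and A: "finite A" "A \<subseteq> {1..K}"
    and M: "\<And>k. k \<in> {1..K} \<Longrightarrow> real (m k) / real F \<le> M" and R: "real (r d) / real F \<le> R"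
  shows "H (insert (Cast d) (Cache ` A)) \<le> real (card A) * M + R"
  using A
proof (induction A rule: finite_induct)
  case empty
  then show ?case
    using H_cast[OF d] R by simp
next
  case (insert k A)
  have "H (insert (Cast d) (Cache ` insert k A)) \<le> H (insert (Cast d) (Cache ` A)) + H {Cache k}"
    using H_insert[of "Cache k" "insert (Cast d) (Cache ` A)"] by (simp add: insert_commute)
  also have "\<dots> \<le> real (card A) * M + R + M"
    using insert H_cache[of k] M[of k] by fastforce
  finally show ?case
    using insert by (simp add: algebra_simps)
qed

end

section \<open>Cyclic shifts of one demand\<close>

definition user :: "nat \<Rightarrow> nat \<Rightarrow> nat" where
  "user K x = x mod K + 1"

text \<open>
  Positions \<open>N - 2 - i\<close> and \<open>N - 1 + i\<close> request the same file, so that a transversal of the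
  first \<open>N - 1\<close> files remains one after exchanging the last \<open>e\<close> of the positions below
  \<open>N - 1\<close> for the next \<open>e\<close> positions.
\<close>

definition base_demand :: "nat \<Rightarrow> nat \<Rightarrow> nat \<Rightarrow> nat" where
  "base_demand N K x = (if x < N - 1 then x + 1 else if x < K - 1 then 2 * N - 2 - x else N)"

text \<open>The term \<open>K - c mod K\<close> represents \<open>-c\<close> modulo \<open>K\<close>
  within the naturals, and users are numbered from 1 whereas positions start at 0.\<close>

definition cyclic_demand :: "nat \<Rightarrow> nat \<Rightarrow> nat \<Rightarrow> demand" where
  "cyclic_demand N K c = (\<lambda>k\<in>{1..K}. base_demand N K ((k - 1 + (K - c mod K)) mod K))"

lemma user_in: "0 < K \<Longrightarrow> user K x \<in> {1..K}"
  by (simp add: user_def Suc_leI)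

lemma cyclic_demand_user:
  assumes "x < K"
  shows "cyclic_demand N K c (user K (c + x)) = base_demand N K x"
proof -
  have "((c + x) mod K + (K - c mod K)) mod K = (c + x + (K - c mod K)) mod K"
    by (rule mod_add_left_eq)
  also have "c + x + (K - c mod K) = x + K * (c div K + 1)"
    using assms mult_div_mod_eq[of K c] mod_less_divisor[of K c] unfolding distrib_left by linarith
  also have "\<dots> mod K = x"
    using assms by (subst mod_mult_self2) simp
  finally show ?thesis
    using assms user_in[of K "c + x"] by (simp add: cyclic_demand_def user_def)
qed

lemma cyclic_demand_add: "cyclic_demand N K (c + K) = cyclic_demand N K c"
  by (simp add: cyclic_demand_def)

lemma cyclic_demand_in_demands:
  assumes "2 \<le> N" "N \<le> K" "K + 1 \<le> 2 * N"
  shows "cyclic_demand N K c \<in> demands N K"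
proof -
  \<comment> \<open>In the middle branch \<open>x \<le> K - 2\<close>, so
    \<open>2 * N - 2 - x\<close> is at least \<open>2 * N - K\<close>, which is positive by
    \<open>K + 1 \<le> 2 * N\<close>.\<close>
  have val: "base_demand N K x \<in> {1..N}" for x
    using assms by (auto simp: base_demand_def)
  have "n \<in> cyclic_demand N K c ` {1..K}" if "n \<in> {1..N}" for n
  proof -
    define x where "x = (if n = N then K - 1 else n - 1)"
    have "x < K" "base_demand N K x = n"
      using assms that by (auto simp: x_def base_demand_def)
    then have "n = cyclic_demand N K c (user K (c + x))"
      by (simp add: cyclic_demand_user)
    then show ?thesis
      using user_in[of K] assms by force
  qed
  moreover have "cyclic_demand N K c \<in> {1..K} \<rightarrow>\<^sub>E {1..N}"
    unfolding cyclic_demand_def using val by auto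
  ultimately show ?thesis
    by (auto simp: demands_def)
qed

text \<open>Raising the shift by one moves a single term from the front of the sum to its end, where
  periodicity identifies the two.\<close>

lemma sum_periodic_shift:
  fixes g :: "nat \<Rightarrow> 'a :: cancel_comm_monoid_add"
  assumes "\<And>c. g (c + K) = g c"
  shows "(\<Sum>c<K. g (c + t)) = (\<Sum>c<K. g c)"
proof (induction t)
  case (Suc t)
  have "g t + (\<Sum>c<K. g (c + Suc t)) = (\<Sum>c<Suc K. g (c + t))"
    by (simp only: sum.lessThan_Suc_shift) simp
  also have "\<dots> = g t + (\<Sum>c<K. g (c + t))"
    using assms[of t] by (simp add: add.commute)
  finally show ?case
    using Suc by simp
qed simp

section \<open>Windows of consecutive users and the converse bound\<close>

context caching_scheme
begin

text \<open>The window starts at position 0 of the shifted demand. The user requesting file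
  \<open>N\<close> sits at position \<open>K - 1\<close>, hence outside every window with
  \<open>a < K\<close>.\<close>

definition window_entropy :: "nat \<Rightarrow> nat \<Rightarrow> real" where
  "window_entropy c a =
     H (insert (Cast (cyclic_demand N K c)) (File ` {1..N-1} \<union> Cache ` user K ` {c..<c+a}))"

lemma window_entropy_add: "window_entropy (c + K) a = window_entropy c a"
proof -
  have "user K ` {c + K..<c + K + a} = user K ` (\<lambda>x. x + K) ` {c..<c + a}"
    by (simp add: add.commute add.left_commute)
  also have "\<dots> = user K ` {c..<c + a}"
    unfolding image_image user_def by simp
  finally show ?thesis
    by (simp add: window_entropy_def cyclic_demand_add)
qed

lemma chain_step:
  fixes c i :: nat
  assumes N: "2 \<le> N" "N \<le> K" "K + 1 \<le> 2 * N" and i: "i < K"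
  defines "S \<equiv> \<lambda>i. File ` {1..N-1} \<union> Cache ` user K ` {c+i..<c+K}"
  shows "real N + H (S (Suc i)) \<le> H (S i) + window_entropy (c + Suc i) (K - Suc i)"
proof -
  \<comment> \<open>Shifting by \<open>c + Suc i\<close> puts user \<open>c + i\<close> at position
    \<open>K - 1\<close>, so that this user, whose cache is in \<open>S i\<close>, is the one that
    decodes file \<open>N\<close>.\<close>
  let ?d = "cyclic_demand N K (c + Suc i)"
  let ?T = "insert (Cast ?d) (S (Suc i))"
  have d: "?d \<in> demands N K"
    by (rule cyclic_demand_in_demands[OF N])
  have w: "window_entropy (c + Suc i) (K - Suc i) = H ?T"
    using i by (simp add: window_entropy_def S_def)
  have "{c+i..<c+K} = insert (c+i) {c+Suc i..<c+K}"
    using i by auto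
  then have Si: "S i = insert (Cache (user K (c+i))) (S (Suc i))"
    by (simp add: S_def)
  have int: "S i \<inter> ?T = S (Suc i)"
    unfolding Si by (auto simp: S_def)
  have "user K (c + i) = user K (c + Suc i + (K - 1))"
    using N i by (simp add: user_def)
  moreover have "base_demand N K (K - 1) = N"
    using N by (auto simp: base_demand_def)
  ultimately have "?d (user K (c + i)) = N"
    using N cyclic_demand_user[of "K - 1" K N "c + Suc i"] by simp
  moreover have "{1..N} = insert N {1..N-1}"
    using N by auto
  ultimately have "File ` {1..N} \<subseteq> (S i \<union> ?T) \<union> File ` ?d ` {user K (c+i)}"
    by (auto simp: S_def)
  moreover have "Cache (user K (c+i)) \<in> S i"
    by (simp add: Si)
  ultimately have "H (File ` {1..N}) \<le> H (S i \<union> ?T)"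
    using N user_in[of K "c+i"] by (intro H_decode[OF d, of "{user K (c+i)}"]) simp_all
  then have "real N \<le> H (S i \<union> ?T)"
    using H_files[of N] by simp
  then show ?thesis
    using H_submodular[of "S i" ?T] unfolding w int by linarith
qed

lemma chain_bound:
  assumes N: "2 \<le> N" "N \<le> K" "K + 1 \<le> 2 * N"
  shows "real K * real N - 1 \<le> (\<Sum>i<K. window_entropy (c + Suc i) (K - Suc i))"
proof -
  define S where "S i = File ` {1..N-1} \<union> Cache ` user K ` {c+i..<c+K}" for i
  have "real n * real N + H (S n) \<le> H (S 0) + (\<Sum>i<n. window_entropy (c + Suc i) (K - Suc i))"
    if "n \<le> K" for n
    using that
  proof (induction n)
    case (Suc n)
    then show ?case
      using chain_step[OF N, of n c] by (simp add: S_def algebra_simps)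
  qed simp
  from this[of K] have "real K * real N + H (S K) \<le> H (S 0) + (\<Sum>i<K. window_entropy (c + Suc i) (K - Suc i))"
    by simp
  \<comment> \<open>The last set of the chain contains no caches, only the first
    \<open>N - 1\<close> files. The first set has entropy at most \<open>N\<close>, so the ends of
    the telescope cost 1 in total.\<close>
  moreover have "H (S K) = real N - 1"
    using N H_files[of "N - 1"] by (simp add: S_def of_nat_diff)
  ultimately show ?thesis
    using H_le_N[of "S 0"] by linarith
qed

text \<open>The users at the positions in \<open>U\<close> request all of the first
  \<open>N - 1\<close> files, so those files come for free once their \<open>N - 1\<close> caches
  and the broadcast are counted.\<close>

lemma transversal_bound:
  assumes N: "2 \<le> N" "N \<le> K" "K + 1 \<le> 2 * N"
    and M: "\<And>k. k \<in> {1..K} \<Longrightarrow> real (m k) / real F \<le> M"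
    and R: "\<And>d. d \<in> demands N K \<Longrightarrow> real (r d) / real F \<le> R"
    and U: "U \<subseteq> {..<K}" "card U = N - 1" "{1..N-1} \<subseteq> base_demand N K ` U"
  shows "H (insert (Cast (cyclic_demand N K c)) (File ` {1..N-1} \<union> Cache ` user K ` (+) c ` U))
    \<le> (real N - 1) * M + R"
proof -
  let ?d = "cyclic_demand N K c"
  let ?A = "user K ` (+) c ` U"
  have d: "?d \<in> demands N K"
    by (rule cyclic_demand_in_demands[OF N])
  have fin: "finite U"
    using U(1) finite_subset by blast
  have A: "?A \<subseteq> {1..K}"
    using user_in[of K] N by auto
  have "?d ` ?A = base_demand N K ` U"
    using U(1) by (auto simp: image_image image_iff cyclic_demand_user subset_eq Bex_def)
  then have "H (insert (Cast ?d) (File ` {1..N-1} \<union> Cache ` ?A)) \<le> H (insert (Cast ?d) (Cache ` ?A))"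
    using U(3) by (intro H_decode[OF d _ A]) auto
  also have "\<dots> \<le> real (card ?A) * M + R"
    using A fin by (intro H_caches_cast d M R) auto
  also have "\<dots> \<le> (real N - 1) * M + R"
  proof -
    have "card ?A \<le> N - 1"
      using U(2) card_image_le[OF fin, of "\<lambda>x. user K (c + x)"] by (simp add: image_image)
    \<comment> \<open>Replacing \<open>card ?A\<close> by its upper bound \<open>N - 1\<close> calls
      for a nonnegative factor.\<close>
    moreover have "0 \<le> M"
      using M[of 1] N by (smt (verit) atLeastAtMost_iff divide_nonneg_nonneg of_nat_0_le_iff le_trans one_le_numeral order_refl)
    ultimately have "real (card ?A) * M \<le> real (N - 1) * M"
      by (intro mult_right_mono) auto
    then show ?thesis
      using N by (simp add: of_nat_diff)
  qed
  finally show ?thesis .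
qed

text \<open>Submodularity is applied to two transversals \<open>U\<close> and \<open>V\<close> whose
  union covers the longer window and whose intersection covers the shorter one.\<close>

lemma pair_bound_aux:
  assumes N: "2 \<le> N" "N \<le> K" "K + 1 \<le> 2 * N"
    and M: "\<And>k. k \<in> {1..K} \<Longrightarrow> real (m k) / real F \<le> M"
    and R: "\<And>d. d \<in> demands N K \<Longrightarrow> real (r d) / real F \<le> R"
    and ab: "a + b = K - 1" "b \<le> a"
  shows "window_entropy c a + window_entropy c b \<le> 2 * ((real N - 1) * M + R)"
proof -
  \<comment> \<open>The truncated difference \<open>e\<close> is the excess of the longer window
    over \<open>N - 1\<close> positions. If it is positive, the union of \<open>U\<close> and
    \<open>V\<close> is \<open>{..<a}\<close> and the intersection is \<open>{..<N-1-e}\<close>,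
    which contains \<open>{..<b}\<close> because
    \<open>a + b = K - 1 \<le> 2 * (N - 1)\<close>.\<close>
  define e where "e = a - (N - 1)"
  define U where "U = {..<N-1}"
  define V where "V = {..<N-1-e} \<union> {N-1..<N-1+e}"
  define S where "S A = insert (Cast (cyclic_demand N K c)) (File ` {1..N-1} \<union> Cache ` user K ` (+) c ` A)" for A
  have w: "window_entropy c x = H (S {..<x})" for x
    by (simp add: window_entropy_def S_def lessThan_atLeast0 add.commute)
  have "n \<in> base_demand N K ` U" if "n \<in> {1..N-1}" for n
    using that by (intro image_eqI[of _ _ "n - 1"]) (auto simp: U_def base_demand_def)
  moreover have "U \<subseteq> {..<K}" "card U = N - 1"
    using N by (auto simp: U_def)
  ultimately have HU: "H (S U) \<le> (real N - 1) * M + R"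
    unfolding S_def by (intro transversal_bound[OF N M R]) auto
  have "n \<in> base_demand N K ` V" if "n \<in> {1..N-1}" for n
  proof (cases "n \<le> N - 1 - e")
    case True
    then show ?thesis
      using that by (intro image_eqI[of _ _ "n - 1"]) (auto simp: V_def base_demand_def)
  next
    case False
    \<comment> \<open>The position of file \<open>n\<close> was exchanged away; \<open>x\<close> is
      its mirror image among the \<open>e\<close> new positions and requests the same file.\<close>
    define x where "x = 2 * N - 2 - n"
    have "N - 1 \<le> x" "x < N - 1 + e" "x < K - 1" "n = 2 * N - 2 - x"
      using False that ab N by (auto simp: x_def e_def)
    then show ?thesis
      by (intro image_eqI[of _ _ x]) (auto simp: V_def base_demand_def)
  qed
  moreover have "V \<subseteq> {..<K}"
    using N ab by (auto simp: V_def e_def)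
  moreover have "card V = N - 1"
    using N ab unfolding V_def by (subst card_Un_disjoint) (auto simp: e_def)
  ultimately have HV: "H (S V) \<le> (real N - 1) * M + R"
    unfolding S_def by (intro transversal_bound[OF N M R]) auto
  have "S {..<a} \<subseteq> S U \<union> S V"
    using ab N by (fastforce simp: S_def U_def V_def e_def)
  moreover have "S {..<b} \<subseteq> S U \<inter> S V"
  proof -
    have "{..<b} \<subseteq> U" "{..<b} \<subseteq> V"
      using ab N by (auto simp: U_def V_def e_def)
    then show ?thesis
      unfolding S_def by blast
  qed
  ultimately show ?thesis
    using H_mono[of "S {..<a}" "S U \<union> S V"] H_mono[of "S {..<b}" "S U \<inter> S V"]
      H_submodular[of "S U" "S V"] HU HV by (simp add: w)
qed

text \<open>Summing \<open>chain_bound\<close> over all starting points \<open>c\<close> and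
  realigning each window by periodicity gives every window length from 0 to \<open>K - 1\<close>
  once at each shift. Lengths \<open>a\<close> and \<open>K - 1 - a\<close> are then bounded in
  pairs.\<close>

lemma rate_lower_bound:
  assumes N: "2 \<le> N" "N \<le> K" "K + 1 \<le> 2 * N"
    and M: "\<And>k. k \<in> {1..K} \<Longrightarrow> real (m k) / real F \<le> M"
    and R: "\<And>d. d \<in> demands N K \<Longrightarrow> real (r d) / real F \<le> R"
  shows "(real K * real N - 1) / real K - (real N - 1) * M \<le> R"
proof -
  let ?B = "(real N - 1) * M + R"
  let ?G = "window_entropy"
  have pair: "?G c a + ?G c (K - Suc a) \<le> 2 * ?B" if "a < K" for a c
  proof (cases "K - Suc a \<le> a")
    case True
    then show ?thesis
      using pair_bound_aux[OF N M R, of a "K - Suc a" c] that by simp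
  next
    case False
    then show ?thesis
      using pair_bound_aux[OF N M R, of "K - Suc a" a c] that by simp
  qed
  have flip: "(\<Sum>a<K. ?G c (K - Suc a)) = (\<Sum>a<K. ?G c a)" for c
    by (rule sum.nat_diff_reindex)
  have "(\<Sum>c<K. real K * real N - 1) \<le> (\<Sum>c<K. \<Sum>i<K. ?G (c + Suc i) (K - Suc i))"
    by (intro sum_mono chain_bound[OF N])
  also have "\<dots> = (\<Sum>i<K. \<Sum>c<K. ?G (c + Suc i) (K - Suc i))"
    by (rule sum.swap)
  also have "\<dots> = (\<Sum>i<K. \<Sum>c<K. ?G c (K - Suc i))"
    by (intro sum.cong refl sum_periodic_shift window_entropy_add)
  also have "\<dots> = (\<Sum>c<K. \<Sum>i<K. ?G c i)"
    by (subst sum.swap) (simp add: flip)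
  finally have "real K * (real K * real N - 1) \<le> (\<Sum>c<K. \<Sum>i<K. ?G c i)"
    by simp
  \<comment> \<open>Adding the sum to its own reversal produces the pairs without a case distinction
    on the parity of \<open>K\<close>.\<close>
  moreover have "(\<Sum>c<K. (\<Sum>i<K. ?G c i) + (\<Sum>i<K. ?G c (K - Suc i))) = 2 * (\<Sum>c<K. \<Sum>i<K. ?G c i)"
    unfolding flip by (simp only: sum.distrib mult_2)
  ultimately have "2 * (real K * (real K * real N - 1)) \<le> (\<Sum>c<K. (\<Sum>i<K. ?G c i) + (\<Sum>i<K. ?G c (K - Suc i)))"
    by linarith
  also have "\<dots> = (\<Sum>c<K. \<Sum>i<K. ?G c i + ?G c (K - Suc i))"
    by (simp only: sum.distrib)
  also have "\<dots> \<le> (\<Sum>c<K. \<Sum>i<K. 2 * ?B)"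
    by (intro sum_mono pair) auto
  also have "\<dots> = 2 * (real K * (real K * ?B))"
    by simp
  finally have "real K * (real K * real N - 1) \<le> real K * (real K * ?B)"
    by linarith
  then have "real K * real N - 1 \<le> real K * ?B"
    using N by simp
  then show ?thesis
    using N by (simp add: field_simps)
qed

end

section \<open>Symmetrization and memory sharing\<close>

type_synonym 'i subfiles = "nat \<Rightarrow> 'i \<Rightarrow> bit"

text \<open>
  File \<open>n\<close> consists of the bits indexed by \<open>I n\<close>; cache \<open>k\<close> stores the values of the
  functionals in \<open>P k\<close>, and the broadcast for \<open>d\<close> consists of those in \<open>Q d\<close>.
\<close>

definition subfile_scheme ::
  "nat \<Rightarrow> nat \<Rightarrow> nat \<Rightarrow> nat \<Rightarrow> nat \<Rightarrow> (nat \<Rightarrow> 'i set) \<Rightarrow>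
    (nat \<Rightarrow> ('i subfiles \<Rightarrow> bit) set) \<Rightarrow> (demand \<Rightarrow> ('i subfiles \<Rightarrow> bit) set) \<Rightarrow> bool" where
  "subfile_scheme N K F m r I P Q \<longleftrightarrow>
     (\<forall>n\<in>{1..N}. finite (I n) \<and> card (I n) = F) \<and>
     (\<forall>k\<in>{1..K}. finite (P k) \<and> card (P k) \<le> m) \<and>
     (\<forall>d\<in>demands N K. finite (Q d) \<and> card (Q d) \<le> r) \<and>
     (\<forall>d\<in>demands N K. \<forall>k\<in>{1..K}. \<forall>a b.
        (\<forall>f\<in>P k. f a = f b) \<longrightarrow> (\<forall>f\<in>Q d. f a = f b) \<longrightarrow> (\<forall>i\<in>I (d k). a (d k) i = b (d k) i))"

lemma subfile_scheme_decodes: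
  assumes "subfile_scheme N K F m r I P Q" "d \<in> demands N K" "k \<in> {1..K}"
    "\<forall>f\<in>P k. f a = f b" "\<forall>f\<in>Q d. f a = f b" "i \<in> I (d k)"
  shows "a (d k) i = b (d k) i"
  using assms unfolding subfile_scheme_def by blast

definition enum :: "'a set \<Rightarrow> 'a list" where
  "enum S = (SOME xs. set xs = S \<and> distinct xs)"

lemma enum: "finite S \<Longrightarrow> set (enum S) = S \<and> distinct (enum S)"
  unfolding enum_def by (rule someI_ex) (rule finite_distinct_list)

lemma length_enum: "finite S \<Longrightarrow> length (enum S) = card S"
  using enum[of S] distinct_card by metis

text \<open>The copy indexed by \<open>\<rho> \<circ> inv \<pi>\<close> treats the permuted demand
  exactly as the copy indexed by \<open>\<rho>\<close> treats the original one.\<close>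

lemma permute_demand_comp_inv:
  assumes "\<pi> permutes A" "\<rho> permutes A"
  shows "permute_demand (\<rho> \<circ> inv \<pi>) (permute_demand \<pi> d) = permute_demand \<rho> d"
proof -
  have "inv (\<rho> \<circ> inv \<pi>) = \<pi> \<circ> inv \<rho>"
    using o_inv_distrib[OF permutes_bij[OF assms(2)] permutes_bij[OF permutes_inv[OF assms(1)]]]
    by (simp add: permutes_inv_inv[OF assms(1)])
  moreover have "inv \<pi> \<circ> \<pi> = id"
    by (rule permutes_inv_o(2)[OF assms(1)])
  ultimately show ?thesis
    by (simp add: permute_demand_def comp_assoc) (metis comp_assoc id_comp)
qed

text \<open>Right multiplication by \<open>inv \<pi>\<close> is a bijection of the permutations of
  \<open>A\<close>; this reindexes the copies of a scheme.\<close>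

lemma Ball_permutes_comp_inv:
  assumes "\<pi> permutes A"
  shows "(\<forall>\<rho>. \<rho> permutes A \<longrightarrow> R (\<rho> \<circ> inv \<pi>)) \<longleftrightarrow> (\<forall>\<sigma>. \<sigma> permutes A \<longrightarrow> R \<sigma>)"
proof (intro iffI allI impI)
  fix \<sigma> assume *: "\<forall>\<rho>. \<rho> permutes A \<longrightarrow> R (\<rho> \<circ> inv \<pi>)" and \<sigma>: "\<sigma> permutes A"
  have "\<sigma> \<circ> \<pi> \<circ> inv \<pi> = \<sigma>"
    using permutes_inv_o(1)[OF assms] by (simp add: comp_assoc)
  then show "R \<sigma>"
    using * permutes_compose[OF assms \<sigma>] by metis
qed (use assms in \<open>auto intro: permutes_compose permutes_inv\<close>)

section \<open>Running all permuted copies of several schemes side by side\<close>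

locale subfile_mixture =
  fixes N K :: nat and C :: "'c set" and F m r :: "'c \<Rightarrow> nat" and I :: "'c \<Rightarrow> nat \<Rightarrow> 'i set"
    and P :: "'c \<Rightarrow> nat \<Rightarrow> ('i subfiles \<Rightarrow> bit) set" and Q :: "'c \<Rightarrow> demand \<Rightarrow> ('i subfiles \<Rightarrow> bit) set"
  assumes finite_C: "finite C"
    and scheme: "\<And>c. c \<in> C \<Longrightarrow> subfile_scheme N K (F c) (m c) (r c) (I c) (P c) (Q c)"
    and F_pos: "0 < sum F C"
begin

definition perms :: "(nat \<Rightarrow> nat) set" where
  "perms = {\<sigma>. \<sigma> permutes {1..K}}"

definition bits_per_file :: nat where
  "bits_per_file = fact K * sum F C"

text \<open>Each bit of a file is addressed by the copy, the component scheme and the index within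
  that component.\<close>

definition slots :: "nat \<Rightarrow> ((nat \<Rightarrow> nat) \<times> 'c \<times> 'i) set" where
  "slots n = perms \<times> (SIGMA c:C. I c n)"

definition pos :: "nat \<Rightarrow> (nat \<Rightarrow> nat) \<times> 'c \<times> 'i \<Rightarrow> nat" where
  "pos n = (SOME g. bij_betw g (slots n) {..<bits_per_file})"

text \<open>The part of the files seen by copy \<open>\<sigma>\<close> of component
  \<open>c\<close>. The default 0 makes blocks equal as functions as soon as they agree on the
  genuine indices.\<close>

definition block :: "(nat \<Rightarrow> nat) \<Rightarrow> 'c \<Rightarrow> files \<Rightarrow> 'i subfiles" where
  "block \<sigma> c w n i = (if n \<in> {1..N} \<and> i \<in> I c n then of_bool (w n ! pos n (\<sigma>, c, i)) else 0)"

definition readout :: "((nat \<Rightarrow> nat) \<times> 'c \<times> ('i subfiles \<Rightarrow> bit)) set \<Rightarrow> files \<Rightarrow> bits" where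
  "readout S w = map (\<lambda>(\<sigma>, c, f). f (block \<sigma> c w) = 1) (enum S)"

text \<open>In copy \<open>\<sigma>\<close> user \<open>k\<close> plays the role of user
  \<open>\<sigma> k\<close>; accordingly that copy serves the demand
  \<open>permute_demand \<sigma> d\<close>.\<close>

definition cache_set :: "nat \<Rightarrow> ((nat \<Rightarrow> nat) \<times> 'c \<times> ('i subfiles \<Rightarrow> bit)) set" where
  "cache_set k = (SIGMA \<sigma>:perms. SIGMA c:C. P c (\<sigma> k))"

definition cast_set :: "demand \<Rightarrow> ((nat \<Rightarrow> nat) \<times> 'c \<times> ('i subfiles \<Rightarrow> bit)) set" where
  "cast_set d = (SIGMA \<sigma>:perms. SIGMA c:C. Q c (permute_demand \<sigma> d))"

lemma perms: "finite perms" "card perms = fact K"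
  using finite_permutations[of "{1..K}"] card_permutations[of "{1..K}" K] by (auto simp: perms_def)

lemma bits_per_file_pos: "0 < bits_per_file"
  using F_pos by (simp add: bits_per_file_def)

lemma perms_in: "\<sigma> \<in> perms \<Longrightarrow> k \<in> {1..K} \<Longrightarrow> \<sigma> k \<in> {1..K}"
  by (simp only: perms_def mem_Collect_eq permutes_in_image)

lemma pos: "n \<in> {1..N} \<Longrightarrow> bij_betw (pos n) (slots n) {..<bits_per_file}"
proof -
  assume n: "n \<in> {1..N}"
  have I: "finite (I c n)" "card (I c n) = F c" if "c \<in> C" for c
    using scheme[OF that] n unfolding subfile_scheme_def by blast+
  have "finite (slots n)"
    unfolding slots_def using perms(1) finite_C I(1) by blast
  moreover have "card (slots n) = bits_per_file"
    using finite_C I by (simp add: slots_def card_cartesian_product perms bits_per_file_def)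
  ultimately have "\<exists>g. bij_betw g (slots n) {..<bits_per_file}"
    by (intro finite_same_card_bij) auto
  then show ?thesis
    unfolding pos_def by (rule someI_ex)
qed

lemma file_eq_iff:
  assumes w: "w \<in> file_space N bits_per_file" "w' \<in> file_space N bits_per_file" and n: "n \<in> {1..N}"
  shows "w n = w' n \<longleftrightarrow>
    (\<forall>\<sigma>. \<sigma> permutes {1..K} \<longrightarrow> (\<forall>c\<in>C. \<forall>i\<in>I c n. block \<sigma> c w n i = block \<sigma> c w' n i))"
proof
  assume *: "\<forall>\<sigma>. \<sigma> permutes {1..K} \<longrightarrow> (\<forall>c\<in>C. \<forall>i\<in>I c n. block \<sigma> c w n i = block \<sigma> c w' n i)"
  have len: "length (w n) = bits_per_file" "length (w' n) = bits_per_file"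
    using w n by (auto simp: file_space_def PiE_iff)
  show "w n = w' n"
  proof (rule nth_equalityI)
    fix p assume "p < length (w n)"
    then obtain s where s: "s \<in> slots n" "p = pos n s"
      using bij_betw_imp_surj_on[OF pos[OF n]] len(1) by (metis imageE lessThan_iff)
    obtain \<sigma> c i where sci: "s = (\<sigma>, c, i)"
      by (cases s)
    then have mem: "\<sigma> permutes {1..K}" "c \<in> C" "i \<in> I c n"
      using s(1) by (simp_all add: slots_def perms_def)
    then have "block \<sigma> c w n i = block \<sigma> c w' n i"
      using * by blast
    then show "w n ! p = w' n ! p"
      using mem(3) n by (simp add: s(2) sci block_def of_bool_def split: if_splits)
  qed (simp add: len)
qed (use n in \<open>simp add: block_def\<close>)

lemma readout_eq_iff:
  "finite S \<Longrightarrow> readout S w = readout S w' \<longleftrightarrow>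
    (\<forall>(\<sigma>, c, f)\<in>S. f (block \<sigma> c w) = f (block \<sigma> c w'))"
proof -
  have bit: "(x = 1) = (y = 1) \<longleftrightarrow> x = y" for x y :: bit
    by (cases x; cases y) auto
  assume "finite S"
  then show ?thesis
    unfolding readout_def by (simp add: enum bit split_beta)
qed

lemma length_readout: "finite S \<Longrightarrow> length (readout S w) = card S"
  by (simp add: readout_def length_enum)

lemma cache_set: "k \<in> {1..K} \<Longrightarrow> finite (cache_set k) \<and> card (cache_set k) \<le> fact K * sum m C"
proof -
  assume k: "k \<in> {1..K}"
  have P: "finite (P c (\<sigma> k))" "card (P c (\<sigma> k)) \<le> m c" if "c \<in> C" "\<sigma> \<in> perms" for c \<sigma>
    using scheme[OF that(1)] perms_in[OF that(2) k] unfolding subfile_scheme_def by blast+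
  have "finite (cache_set k)"
    unfolding cache_set_def using perms(1) finite_C P(1) by blast
  moreover have "card (cache_set k) = (\<Sum>\<sigma>\<in>perms. \<Sum>c\<in>C. card (P c (\<sigma> k)))"
    using perms(1) finite_C P(1) by (simp add: cache_set_def)
  moreover have "\<dots> \<le> (\<Sum>\<sigma>\<in>perms. \<Sum>c\<in>C. m c)"
    by (intro sum_mono P(2))
  ultimately show ?thesis
    by (simp add: perms)
qed

lemma cast_set: "d \<in> demands N K \<Longrightarrow> finite (cast_set d) \<and> card (cast_set d) \<le> fact K * sum r C"
proof -
  assume d: "d \<in> demands N K"
  have Q: "finite (Q c (permute_demand \<sigma> d))" "card (Q c (permute_demand \<sigma> d)) \<le> r c"
    if "c \<in> C" "\<sigma> \<in> perms" for c \<sigma>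
    using scheme[OF that(1)] permute_demand_in_demands[OF _ d, of \<sigma>] that(2)
    unfolding subfile_scheme_def perms_def by blast+
  have "finite (cast_set d)"
    unfolding cast_set_def using perms(1) finite_C Q(1) by blast
  moreover have "card (cast_set d) = (\<Sum>\<sigma>\<in>perms. \<Sum>c\<in>C. card (Q c (permute_demand \<sigma> d)))"
    using perms(1) finite_C Q(1) by (simp add: cast_set_def)
  moreover have "\<dots> \<le> (\<Sum>\<sigma>\<in>perms. \<Sum>c\<in>C. r c)"
    by (intro sum_mono Q(2))
  ultimately show ?thesis
    by (simp add: perms)
qed

lemma cache_eq_iff:
  "k \<in> {1..K} \<Longrightarrow> readout (cache_set k) w = readout (cache_set k) w' \<longleftrightarrow>
    (\<forall>\<sigma>. \<sigma> permutes {1..K} \<longrightarrow> (\<forall>c\<in>C. \<forall>f\<in>P c (\<sigma> k). f (block \<sigma> c w) = f (block \<sigma> c w')))"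
  using cache_set[of k] by (simp add: readout_eq_iff) (auto simp: cache_set_def perms_def)

lemma cast_eq_iff:
  "d \<in> demands N K \<Longrightarrow> readout (cast_set d) w = readout (cast_set d) w' \<longleftrightarrow>
    (\<forall>\<sigma>. \<sigma> permutes {1..K} \<longrightarrow>
      (\<forall>c\<in>C. \<forall>f\<in>Q c (permute_demand \<sigma> d). f (block \<sigma> c w) = f (block \<sigma> c w')))"
  using cast_set[of d] by (simp add: readout_eq_iff) (auto simp: cast_set_def perms_def)

text \<open>In copy \<open>\<sigma>\<close> the role \<open>\<sigma> k\<close> requests file
  \<open>d k\<close>, so each component recovers its share of that file, and the shares make up the
  whole file.\<close>

lemma mixture_decodable:
  assumes d: "d \<in> demands N K" and k: "k \<in> {1..K}"
    and w: "w \<in> file_space N bits_per_file" "w' \<in> file_space N bits_per_file"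
    and Z: "readout (cache_set k) w = readout (cache_set k) w'"
    and X: "readout (cast_set d) w = readout (cast_set d) w'"
  shows "w (d k) = w' (d k)"
proof -
  have dk: "d k \<in> {1..N}"
    using d k by (auto simp: demands_def)
  have "block \<sigma> c w (d k) i = block \<sigma> c w' (d k) i"
    if \<sigma>: "\<sigma> permutes {1..K}" and c: "c \<in> C" and i: "i \<in> I c (d k)" for \<sigma> c i
  proof -
    have "permute_demand \<sigma> d \<in> demands N K" "\<sigma> k \<in> {1..K}"
      using permute_demand_in_demands[OF \<sigma> d] k by (simp_all only: permutes_in_image[OF \<sigma>])
    moreover have "permute_demand \<sigma> d (\<sigma> k) = d k"
      using permutes_inverses(2)[OF \<sigma>] by (simp add: permute_demand_def)
    moreover have "\<forall>f\<in>P c (\<sigma> k). f (block \<sigma> c w) = f (block \<sigma> c w')"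
      using Z \<sigma> c by (simp add: cache_eq_iff[OF k])
    moreover have "\<forall>f\<in>Q c (permute_demand \<sigma> d). f (block \<sigma> c w) = f (block \<sigma> c w')"
      using X \<sigma> c by (simp add: cast_eq_iff[OF d])
    ultimately show ?thesis
      using subfile_scheme_decodes[OF scheme[OF c], of "permute_demand \<sigma> d" "\<sigma> k"] i by simp
  qed
  then show ?thesis
    using file_eq_iff[OF w dk] by blast
qed

section \<open>Symmetry of the mixture\<close>

text \<open>A rearrangement of the bits within each file: copy \<open>\<rho>\<close> of the new
  files holds what copy \<open>\<rho> \<circ> inv \<pi>\<close> held before. It is the change of
  variables that undoes a permutation of the users.\<close>

definition relabel :: "(nat \<Rightarrow> nat) \<Rightarrow> files \<Rightarrow> files" where
  "relabel \<pi> w = (\<lambda>n\<in>{1..N}. map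
     (\<lambda>p. case inv_into (slots n) (pos n) p of (\<rho>, s) \<Rightarrow> w n ! pos n (\<rho> \<circ> inv \<pi>, s)) [0..<bits_per_file])"

lemma relabel_in: "relabel \<pi> w \<in> file_space N bits_per_file"
  by (auto simp: relabel_def file_space_def)

lemma block_relabel:
  assumes "\<rho> permutes {1..K}" "c \<in> C"
  shows "block \<rho> c (relabel \<pi> w) = block (\<rho> \<circ> inv \<pi>) c w"
proof -
  have "relabel \<pi> w n ! pos n (\<rho>, c, i) = w n ! pos n (\<rho> \<circ> inv \<pi>, c, i)"
    if n: "n \<in> {1..N}" and i: "i \<in> I c n" for n i
  proof -
    have s: "(\<rho>, c, i) \<in> slots n"
      using assms i by (auto simp: slots_def perms_def)
    then have "pos n (\<rho>, c, i) < bits_per_file"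
      using pos[OF n] bij_betwE by blast
    moreover have "inv_into (slots n) (pos n) (pos n (\<rho>, c, i)) = (\<rho>, c, i)"
      using s pos[OF n] by (simp add: bij_betw_def)
    ultimately show ?thesis
      using n by (simp add: relabel_def)
  qed
  then show ?thesis
    by (auto simp: block_def fun_eq_iff)
qed

lemma relabel_file_eq_iff:
  assumes "\<pi> permutes {1..K}"
    and w: "w \<in> file_space N bits_per_file" "w' \<in> file_space N bits_per_file" and n: "n \<in> {1..N}"
  shows "relabel \<pi> w n = relabel \<pi> w' n \<longleftrightarrow> w n = w' n"
  unfolding file_eq_iff[OF w n] file_eq_iff[OF relabel_in relabel_in n]
    Ball_permutes_comp_inv[OF assms(1), of "\<lambda>\<sigma>. \<forall>c\<in>C. \<forall>i\<in>I c n. block \<sigma> c w n i = block \<sigma> c w' n i", symmetric]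
  by (simp add: block_relabel)

lemma bij_relabel:
  assumes "\<pi> permutes {1..K}"
  shows "bij_betw (relabel \<pi>) (file_space N bits_per_file) (file_space N bits_per_file)"
proof -
  have "inj_on (relabel \<pi>) (file_space N bits_per_file)"
  proof (rule inj_onI)
    fix w w' assume w: "w \<in> file_space N bits_per_file" "w' \<in> file_space N bits_per_file"
      and eq: "relabel \<pi> w = relabel \<pi> w'"
    have "w n = w' n" if "n \<in> {1..N}" for n
      using relabel_file_eq_iff[OF assms w that] eq by simp
    then show "w = w'"
      using w unfolding file_space_def by (intro PiE_ext)
  qed
  moreover have "relabel \<pi> ` file_space N bits_per_file \<subseteq> file_space N bits_per_file"
    using relabel_in by blast
  ultimately show ?thesis
    using endo_inj_surj[OF finite_file_space] by (auto simp: bij_betw_def)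
qed

lemma symmetric_mixture:
  "symmetric_caching_scheme N K bits_per_file (\<lambda>k. card (cache_set k)) (\<lambda>d. card (cast_set d))
     (\<lambda>k. readout (cache_set k)) (\<lambda>d. readout (cast_set d))"
proof
  show "0 < bits_per_file"
    by (rule bits_per_file_pos)
  show "length (readout (cache_set k) w) = card (cache_set k)" if "k \<in> {1..K}" for k w
    using cache_set[OF that] by (simp add: length_readout)
  show "length (readout (cast_set d) w) = card (cast_set d)" if "d \<in> demands N K" for d w
    using cast_set[OF that] by (simp add: length_readout)
  show "\<exists>\<psi>. \<forall>w\<in>file_space N bits_per_file. w (d k) = \<psi> (readout (cache_set k) w) (readout (cast_set d) w)"
    if d: "d \<in> demands N K" and k: "k \<in> {1..K}" for d k
  proof -
    \<comment> \<open>The decoder picks any file tuple consistent with what the user sees; by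
      \<open>mixture_decodable\<close> all of them have the same requested file.\<close>
    define \<psi> where "\<psi> z x = (SOME v. \<exists>w\<in>file_space N bits_per_file.
      readout (cache_set k) w = z \<and> readout (cast_set d) w = x \<and> v = w (d k))" for z x
    have "w (d k) = \<psi> (readout (cache_set k) w) (readout (cast_set d) w)"
      if w: "w \<in> file_space N bits_per_file" for w
    proof -
      have "\<exists>v. \<exists>w'\<in>file_space N bits_per_file. readout (cache_set k) w' = readout (cache_set k) w \<and>
          readout (cast_set d) w' = readout (cast_set d) w \<and> v = w' (d k)"
        using w by blast
      from someI_ex[OF this] show ?thesis
        unfolding \<psi>_def[symmetric] using mixture_decodable[OF d k _ w] by auto
    qed
    then show ?thesis
      by blast
  qed
  show "entropyF N bits_per_file
      (\<lambda>w. (w (d l), readout (cache_set (\<pi> l)) w, readout (cast_set (permute_demand \<pi> d)) w)) =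
    entropyF N bits_per_file (\<lambda>w. (w (d l), readout (cache_set l) w, readout (cast_set d) w))"
    if \<pi>: "\<pi> permutes {1..K}" and d: "d \<in> demands N K" and l: "l \<in> {1..K}" for \<pi> d l
  proof (rule entropyF_bij_cong[OF bij_relabel[OF \<pi>], symmetric])
    fix w w' assume w: "w \<in> file_space N bits_per_file" "w' \<in> file_space N bits_per_file"
    have \<pi>d: "permute_demand \<pi> d \<in> demands N K" and \<pi>l: "\<pi> l \<in> {1..K}" and dl: "d l \<in> {1..N}"
      using permute_demand_in_demands[OF \<pi> d] permutes_in_image[OF \<pi>] l d by (auto simp: demands_def)
    \<comment> \<open>After relabelling, user \<open>l\<close> reads the same functionals of the
      same blocks as user \<open>\<pi> l\<close> reads of the original files.\<close>
    have comp: "(\<rho> \<circ> inv \<pi>) (\<pi> l) = \<rho> l" for \<rho>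
      using permutes_inverses(2)[OF \<pi>] by simp
    have "readout (cache_set l) (relabel \<pi> w) = readout (cache_set l) (relabel \<pi> w') \<longleftrightarrow>
        readout (cache_set (\<pi> l)) w = readout (cache_set (\<pi> l)) w'"
      unfolding cache_eq_iff[OF l] cache_eq_iff[OF \<pi>l]
        Ball_permutes_comp_inv[OF \<pi>, of "\<lambda>\<sigma>. \<forall>c\<in>C. \<forall>f\<in>P c (\<sigma> (\<pi> l)). f (block \<sigma> c w) = f (block \<sigma> c w')",
          symmetric] comp
      by (simp add: block_relabel)
    moreover have "readout (cast_set d) (relabel \<pi> w) = readout (cast_set d) (relabel \<pi> w') \<longleftrightarrow>
        readout (cast_set (permute_demand \<pi> d)) w = readout (cast_set (permute_demand \<pi> d)) w'"
      unfolding cast_eq_iff[OF d] cast_eq_iff[OF \<pi>d]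
        Ball_permutes_comp_inv[OF \<pi>, of "\<lambda>\<sigma>. \<forall>c\<in>C. \<forall>f\<in>Q c (permute_demand \<sigma> (permute_demand \<pi> d)).
          f (block \<sigma> c w) = f (block \<sigma> c w')", symmetric]
      by (simp add: block_relabel permute_demand_comp_inv[OF \<pi>])
    ultimately show "((relabel \<pi> w) (d l), readout (cache_set l) (relabel \<pi> w), readout (cast_set d) (relabel \<pi> w)) =
        ((relabel \<pi> w') (d l), readout (cache_set l) (relabel \<pi> w'), readout (cast_set d) (relabel \<pi> w')) \<longleftrightarrow>
        (w (d l), readout (cache_set (\<pi> l)) w, readout (cast_set (permute_demand \<pi> d)) w) =
        (w' (d l), readout (cache_set (\<pi> l)) w', readout (cast_set (permute_demand \<pi> d)) w')"
      using relabel_file_eq_iff[OF \<pi> w dl] by simp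
  qed
qed

text \<open>Cache and broadcast sizes are at most \<open>fact K\<close> times the totals over
  \<open>C\<close>, and this factor cancels against \<open>bits_per_file\<close>.\<close>

lemma achievable_mixture:
  assumes N: "1 \<le> N" "N \<le> K"
    and M: "real (sum m C) \<le> M * real (sum F C)" and R: "real (sum r C) \<le> R * real (sum F C)"
  shows "achievable N K M R"
proof -
  have ratio: "real x / real bits_per_file \<le> B"
    if "x \<le> fact K * y" "real y \<le> B * real (sum F C)" for x y B
  proof -
    have "real x \<le> fact K * real y"
      using of_nat_mono[OF that(1), where 'a = real] by simp
    also have "\<dots> \<le> fact K * (B * real (sum F C))"
      using that(2) by (intro mult_left_mono) auto
    finally have "real x \<le> B * real bits_per_file"
      by (simp add: bits_per_file_def algebra_simps)
    then show ?thesis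
      using bits_per_file_pos by (simp add: divide_le_eq)
  qed
  have "scheme_rate N K bits_per_file (\<lambda>d. card (cast_set d)) \<le> R"
    unfolding scheme_rate_def using finite_demands demands_nonempty[OF N]
    by (intro Max.boundedI) (auto intro!: ratio[OF _ R] conjunct2[OF cast_set])
  moreover have "\<forall>k\<in>{1..K}. real (card (cache_set k)) / real bits_per_file \<le> M"
    by (intro ballI ratio[OF _ M] conjunct2[OF cache_set])
  ultimately show ?thesis
    unfolding achievable_def using symmetric_mixture by blast
qed

end

section \<open>The two corner points\<close>

definition leader :: "nat \<Rightarrow> demand \<Rightarrow> nat \<Rightarrow> nat" where
  "leader K d n = (SOME k. k \<in> {1..K} \<and> d k = n)"

lemma leader:
  assumes "d \<in> demands N K" "n \<in> {1..N}"
  shows "leader K d n \<in> {1..K}" "d (leader K d n) = n"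
proof -
  have "n \<in> d ` {1..K}"
    using assms by (simp add: demands_def)
  then have "\<exists>k. k \<in> {1..K} \<and> d k = n"
    by blast
  from someI_ex[OF this] show "leader K d n \<in> {1..K}" "d (leader K d n) = n"
    by (simp_all add: leader_def)
qed

lemma card_non_leaders:
  assumes "d \<in> demands N K"
  shows "card ({1..K} - leader K d ` {1..N}) = K - N"
proof -
  have "inj_on (leader K d) {1..N}"
    using leader(2)[OF assms] by (rule inj_on_inverseI)
  moreover have "leader K d ` {1..N} \<subseteq> {1..K}"
    using leader(1)[OF assms] by blast
  ultimately show ?thesis
    by (simp add: card_Diff_subset card_image)
qed

lemma card_unrequested:
  assumes "d \<in> demands N K"
  shows "card ({1..N} \<times> {1..K} - (\<lambda>k. (d k, k)) ` {1..K}) = N * K - K"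
proof -
  have "inj_on (\<lambda>k. (d k, k)) {1..K}"
    by (auto intro: inj_onI)
  moreover have "(\<lambda>k. (d k, k)) ` {1..K} \<subseteq> {1..N} \<times> {1..K}"
    using assms by (auto simp: demands_def)
  ultimately show ?thesis
    by (simp add: card_Diff_subset card_image)
qed

text \<open>This is how a user solves a cached sum for its one unknown bit.\<close>

lemma sum_eq_imp_eq:
  fixes f g :: "'a \<Rightarrow> 'b :: ab_group_add"
  assumes "finite A" "x \<in> A" "sum f A = sum g A" "\<And>y. y \<in> A \<Longrightarrow> y \<noteq> x \<Longrightarrow> f y = g y"
  shows "f x = g x"
proof -
  have "sum f (A - {x}) = sum g (A - {x})"
    using assms(4) by (intro sum.cong) auto
  then show ?thesis
    using assms(3) by (simp add: sum.remove[OF assms(1,2)])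
qed

section \<open>The corner point with cache size 1 / K\<close>

text \<open>Each file is split into \<open>K\<close> bits, one for each user. The constant second
  index 0 gives this scheme the same index type as the other corner scheme, so that both fit into
  one mixture.\<close>

definition sum_cache :: "nat \<Rightarrow> nat \<Rightarrow> ((nat \<times> nat) subfiles \<Rightarrow> bit) set" where
  "sum_cache N k = {\<lambda>a. \<Sum>n\<in>{1..N}. a n (k, 0)}"

definition sum_cast :: "nat \<Rightarrow> nat \<Rightarrow> demand \<Rightarrow> ((nat \<times> nat) subfiles \<Rightarrow> bit) set" where
  "sum_cast N K d =
     (\<lambda>(n, j) a. a n (j, 0)) ` ({1..N} \<times> {1..K} - (\<lambda>k. (d k, k)) ` {1..K}) \<union>
     (\<lambda>j a. a (d j) (j, 0) + a (d j) (leader K d (d j), 0)) ` ({1..K} - leader K d ` {1..N})"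

text \<open>All bits \<open>a n (j, 0)\<close> with \<open>n \<noteq> d j\<close> are sent in the
  clear. User \<open>k\<close> therefore solves its cached sum for bit \<open>k\<close> of its own
  file, and passes through the leader to the bits of the other users with the same request.\<close>

lemma subfile_scheme_sum:
  assumes N: "1 \<le> N" "N \<le> K"
  shows "subfile_scheme N K K 1 (N * (K - 1)) (\<lambda>_. {1..K} \<times> {0}) (sum_cache N) (sum_cast N K)"
  unfolding subfile_scheme_def
proof (intro conjI ballI allI impI)
  fix d assume d: "d \<in> demands N K"
  let ?R = "{1..N} \<times> {1..K} - (\<lambda>k. (d k, k)) ` {1..K}" and ?L = "{1..K} - leader K d ` {1..N}"
  show "finite (sum_cast N K d)"
    by (simp add: sum_cast_def)
  have "card (sum_cast N K d) \<le> card ?R + card ?L"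
    unfolding sum_cast_def
    by (rule order_trans[OF card_Un_le]) (intro add_mono card_image_le; simp)
  also have "\<dots> = (N * K - K) + (K - N)"
    by (simp only: card_non_leaders[OF d] card_unrequested[OF d])
  also have "\<dots> = N * (K - 1)"
    using N by (cases N) (auto simp: algebra_simps)
  finally show "card (sum_cast N K d) \<le> N * (K - 1)" .
next
  fix d k i and a b :: "(nat \<times> nat) subfiles"
  assume d: "d \<in> demands N K" and k: "k \<in> {1..K}"
    and P: "\<forall>f\<in>sum_cache N k. f a = f b" and Q: "\<forall>f\<in>sum_cast N K d. f a = f b"
    and i: "i \<in> {1..K} \<times> {0 :: nat}"
  obtain j where ij: "i = (j, 0)" and j: "j \<in> {1..K}"
    using i by auto
  have dk: "d k \<in> {1..N}"
    using d k by (auto simp: demands_def)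
  have direct: "a n (j, 0) = b n (j, 0)" if "n \<in> {1..N}" "j \<in> {1..K}" "d j \<noteq> n" for n j
  proof -
    have "(\<lambda>a :: (nat \<times> nat) subfiles. a n (j, 0)) \<in> sum_cast N K d"
      unfolding sum_cast_def using that by (intro UnI1 image_eqI[of _ _ "(n, j)"]) auto
    from Q this show ?thesis
      by (rule bspec)
  qed
  \<comment> \<open>For a leader nothing is broadcast, but then both summands coincide.\<close>
  have differences: "a (d j) (j, 0) + a (d j) (leader K d (d j), 0) = b (d j) (j, 0) + b (d j) (leader K d (d j), 0)"
    if "j \<in> {1..K}" for j
  proof (cases "j \<in> leader K d ` {1..N}")
    case True
    then have "leader K d (d j) = j"
      using leader(2)[OF d] by auto
    then show ?thesis
      by simp
  next
    case False
    have "(\<lambda>a :: (nat \<times> nat) subfiles. a (d j) (j, 0) + a (d j) (leader K d (d j), 0)) \<in> sum_cast N K d"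
      unfolding sum_cast_def using that False by (intro UnI2 image_eqI[of _ _ j]) auto
    from Q this show ?thesis
      by (rule bspec)
  qed
  have own: "a (d k) (k, 0) = b (d k) (k, 0)"
  proof (rule sum_eq_imp_eq[of "{1..N}" "d k" "\<lambda>n. a n (k, 0)" "\<lambda>n. b n (k, 0)"])
    show "(\<Sum>n\<in>{1..N}. a n (k, 0)) = (\<Sum>n\<in>{1..N}. b n (k, 0))"
      using P by (simp add: sum_cache_def)
  qed (use dk k direct in auto)
  show "a (d k) i = b (d k) i"
  proof (cases "d j = d k")
    case True
    have "a (d k) (leader K d (d k), 0) = b (d k) (leader K d (d k), 0)"
      using differences[OF k] own by (metis add_left_cancel)
    then show ?thesis
      using differences[OF j] True ij by (metis add_right_cancel)
  next
    case False
    then show ?thesis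
      using direct[OF dk j] by (simp add: ij)
  qed
qed (simp_all add: sum_cache_def)

section \<open>The corner point with cache size N / (K (N - 1))\<close>

text \<open>A fixed user not requesting file \<open>n\<close>, available because at least two files
  are requested. Its bit of file \<open>n\<close> is the reference bit to which the others are
  compared.\<close>

definition outsider :: "nat \<Rightarrow> demand \<Rightarrow> nat \<Rightarrow> nat" where
  "outsider K d n = leader K d (if n = 1 then 2 else 1)"

lemma outsider:
  assumes "d \<in> demands N K" "2 \<le> N"
  shows "outsider K d n \<in> {1..K}" "d (outsider K d n) \<noteq> n" "d (outsider K d n) \<in> {1..N}"
  using leader[OF assms(1), of "if n = 1 then 2 else 1"] assms(2) by (auto simp: outsider_def)

text \<open>File \<open>n\<close> has one bit for each user \<open>k\<close> and each label
  \<open>s \<noteq> n\<close>, so the cached sum with label \<open>s\<close> runs over exactly the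
  files that carry this label.\<close>

definition leave_one_out_cache :: "nat \<Rightarrow> nat \<Rightarrow> ((nat \<times> nat) subfiles \<Rightarrow> bit) set" where
  "leave_one_out_cache N k = (\<lambda>s a. \<Sum>n\<in>{1..N}-{s}. a n (k, s)) ` {1..N}"

text \<open>
  The last two sets save \<open>N - 1\<close> bits on the \<open>K (N - 1)\<close> values \<open>a n (j, d j)\<close> with
  \<open>n \<noteq> d j\<close>: they reveal these up to unknowns \<open>L n\<close>, one for each file, with sum \<open>0\<close>.
  A user requesting \<open>n\<close> caches the sum of the \<open>L m\<close> with \<open>m \<noteq> n\<close>, which equals \<open>L n\<close>.
\<close>

definition leave_one_out_cast :: "nat \<Rightarrow> nat \<Rightarrow> demand \<Rightarrow> ((nat \<times> nat) subfiles \<Rightarrow> bit) set" where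
  "leave_one_out_cast N K d =
     (\<lambda>(j, s) a. a (d j) (j, s) + a (d j) (leader K d (d j), s)) `
       (SIGMA j:{1..K} - leader K d ` {1..N}. {1..N} - {d j}) \<union>
     (\<lambda>(j, n, s) a. a n (j, s)) ` (SIGMA j:{1..K}. SIGMA n:{1..N} - {d j}. {1..N} - {d j, n}) \<union>
     (\<lambda>(n, j) a. a n (j, d j) + a n (outsider K d n, d (outsider K d n))) `
       ({1..N} \<times> {1..K} - (\<lambda>k. (d k, k)) ` {1..K} - (\<lambda>n. (n, outsider K d n)) ` {1..N}) \<union>
     {\<lambda>a. \<Sum>n\<in>{1..N}. a n (outsider K d n, d (outsider K d n))}"

lemma card_leave_one_out_cast:
  assumes N: "2 \<le> N" "N \<le> K" and d: "d \<in> demands N K"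
  shows "card (leave_one_out_cast N K d) \<le> (N - 1) * (N * (K - 1) - 1)"
proof -
  let ?R = "{1..N} \<times> {1..K} - (\<lambda>k. (d k, k)) ` {1..K}" and ?L = "{1..K} - leader K d ` {1..N}"
  let ?A = "SIGMA j:?L. {1..N} - {d j}"
  let ?B = "SIGMA j:{1..K}. SIGMA n:{1..N} - {d j}. {1..N} - {d j, n}"
  let ?C = "?R - (\<lambda>n. (n, outsider K d n)) ` {1..N}"
  have dj: "d j \<in> {1..N}" if "j \<in> {1..K}" for j
    using d that by (auto simp: demands_def)
  have "card ?A = (\<Sum>j\<in>?L. card ({1..N} - {d j}))"
    by simp
  also have "\<dots> = (\<Sum>j\<in>?L. N - 1)"
    using dj by (intro sum.cong refl) (subst card_Diff_singleton, auto)
  also have "\<dots> = (K - N) * (N - 1)"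
    using card_non_leaders[OF d] by simp
  finally have A: "card ?A = (K - N) * (N - 1)" .
  have "card ?B = (\<Sum>j\<in>{1..K}. \<Sum>n\<in>{1..N} - {d j}. card ({1..N} - {d j, n}))"
    by (subst card_SigmaI) (auto intro!: sum.cong card_SigmaI)
  also have "\<dots> = (\<Sum>j\<in>{1..K}. \<Sum>n\<in>{1..N} - {d j}. N - 2)"
  proof (intro sum.cong refl)
    fix j n assume "j \<in> {1..K}" "n \<in> {1..N} - {d j}"
    then show "card ({1..N} - {d j, n}) = N - 2"
      using dj[of j] by (subst card_Diff_subset) auto
  qed
  also have "\<dots> = (\<Sum>j\<in>{1..K}. (N - 1) * (N - 2))"
    using dj by (intro sum.cong refl) (simp add: card_Diff_singleton)
  finally have B: "card ?B = K * (N - 1) * (N - 2)"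
    by simp
  have "inj_on (\<lambda>n. (n, outsider K d n)) {1..N}"
    by (auto intro: inj_onI)
  moreover have "(\<lambda>n. (n, outsider K d n)) ` {1..N} \<subseteq> ?R"
  proof (intro image_subsetI DiffI)
    fix n assume "n \<in> {1..N}"
    then show "(n, outsider K d n) \<in> {1..N} \<times> {1..K}"
      using outsider(1)[OF d N(1)] by blast
    show "(n, outsider K d n) \<notin> (\<lambda>k. (d k, k)) ` {1..K}"
      using outsider(2)[OF d N(1), of n] by auto
  qed
  ultimately have C: "card ?C = N * K - K - N"
    using card_unrequested[OF d] by (simp add: card_Diff_subset card_image)
  have fin: "finite ?A" "finite ?B" "finite ?C"
    by auto
  have "card (leave_one_out_cast N K d) \<le> card ?A + card ?B + card ?C + 1"
    unfolding leave_one_out_cast_def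
    by (intro order_trans[OF card_Un_le] add_mono card_image_le fin) simp
  also have "\<dots> = (K - N) * (N - 1) + K * (N - 1) * (N - 2) + (N * K - K - N) + 1"
    by (simp only: A B C)
  also have "\<dots> = (N - 1) * (N * (K - 1) - 1)"
  proof -
    \<comment> \<open>The substitution removes all truncated subtractions, leaving a polynomial
      identity.\<close>
    define x where "x = N - 2"
    define y where "y = K - N"
    have "N = x + 2" "K = y + x + 2"
      using N by (simp_all add: x_def y_def)
    then show ?thesis
      by (simp add: algebra_simps)
  qed
  finally show ?thesis .
qed

text \<open>Three cases for bit \<open>(j, s)\<close> of the requested file. If user
  \<open>j\<close> has the same request, the cached sum with label \<open>s\<close> and the leader
  give the bit. If \<open>d j\<close> differs from both \<open>d k\<close> and \<open>s\<close>, the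
  bit is broadcast in the clear. If \<open>d j = s\<close>, it is known up to the reference bit of
  file \<open>d k\<close>.\<close>

lemma leave_one_out_decodes:
  fixes a b :: "(nat \<times> nat) subfiles"
  assumes N: "2 \<le> N" and d: "d \<in> demands N K" and k: "k \<in> {1..K}"
    and P: "\<forall>f\<in>leave_one_out_cache N k. f a = f b"
    and Q: "\<forall>f\<in>leave_one_out_cast N K d. f a = f b"
    and j: "j \<in> {1..K}" and s: "s \<in> {1..N}" "s \<noteq> d k"
  shows "a (d k) (j, s) = b (d k) (j, s)"
proof -
  let ?o = "\<lambda>n. (outsider K d n, d (outsider K d n))"
  have d_in: "d j \<in> {1..N}" if "j \<in> {1..K}" for j
    using d that by (auto simp: demands_def)
  note dk = d_in[OF k]
  have cached: "(\<Sum>n\<in>{1..N}-{s}. a n (k, s)) = (\<Sum>n\<in>{1..N}-{s}. b n (k, s))" if "s \<in> {1..N}" for s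
    using P that by (auto simp: leave_one_out_cache_def)
  have same: "a (d j) (j, s) + a (d j) (leader K d (d j), s) = b (d j) (j, s) + b (d j) (leader K d (d j), s)"
    if "j \<in> {1..K}" "s \<in> {1..N}" "s \<noteq> d j" for j s
  proof (cases "j \<in> leader K d ` {1..N}")
    case True
    then have "leader K d (d j) = j"
      using leader(2)[OF d] by auto
    then show ?thesis
      by simp
  next
    case False
    have "(\<lambda>a :: (nat \<times> nat) subfiles. a (d j) (j, s) + a (d j) (leader K d (d j), s)) \<in> leave_one_out_cast N K d"
      unfolding leave_one_out_cast_def using that False
      by (intro UnI1 image_eqI[of _ _ "(j, s)"]) auto
    from Q this show ?thesis
      by (rule bspec)
  qed
  have direct: "a n (j, s) = b n (j, s)"
    if "j \<in> {1..K}" "n \<in> {1..N}" "s \<in> {1..N}" "n \<noteq> d j" "s \<noteq> d j" "n \<noteq> s" for j n s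
  proof -
    have "(\<lambda>a :: (nat \<times> nat) subfiles. a n (j, s)) \<in> leave_one_out_cast N K d"
      unfolding leave_one_out_cast_def using that
      by (intro UnI1 UnI2[of _ "(\<lambda>(j, n, s) a. a n (j, s)) ` _"] image_eqI[of _ _ "(j, n, s)"]) auto
    from Q this show ?thesis
      by (rule bspec)
  qed
  have cross: "a n (j, d j) + a n (?o n) = b n (j, d j) + b n (?o n)"
    if "j \<in> {1..K}" "n \<in> {1..N}" "d j \<noteq> n" for j n
  proof (cases "j = outsider K d n")
    case False
    have "(\<lambda>a :: (nat \<times> nat) subfiles. a n (j, d j) + a n (?o n)) \<in> leave_one_out_cast N K d"
      unfolding leave_one_out_cast_def using that False
      by (intro UnI1 UnI2[of _ "(\<lambda>(n, j) a. a n (j, d j) + a n (?o n)) ` _"] image_eqI[of _ _ "(n, j)"]) auto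
    from Q this show ?thesis
      by (rule bspec)
  qed simp
  have total: "(\<Sum>n\<in>{1..N}. a n (?o n)) = (\<Sum>n\<in>{1..N}. b n (?o n))"
    using Q by (auto simp: leave_one_out_cast_def)
  show ?thesis
  proof (cases "d j = d k")
    case True
    have "a (d k) (k, s) = b (d k) (k, s)"
    proof (rule sum_eq_imp_eq[of "{1..N} - {s}" "d k" "\<lambda>n. a n (k, s)" "\<lambda>n. b n (k, s)"])
      show "(\<Sum>n\<in>{1..N}-{s}. a n (k, s)) = (\<Sum>n\<in>{1..N}-{s}. b n (k, s))"
        by (rule cached[OF s(1)])
    qed (use dk k s direct in auto)
    then have "a (d k) (leader K d (d k), s) = b (d k) (leader K d (d k), s)"
      using same[OF k s] by (metis add_left_cancel)
    then show ?thesis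
      using same[of j s] True j s by (metis add_right_cancel)
  next
    case jk: False
    show ?thesis
    proof (cases "d j = s")
      case False
      then show ?thesis
        using direct[of j "d k" s] jk j dk s by auto
    next
      case True
      \<comment> \<open>The first summands add up to the cached sum with label \<open>d k\<close>.
        Removing it leaves the sum of the reference bits of all other files, and the broadcast total
        then yields the reference bit of file \<open>d k\<close>.\<close>
      have "(\<Sum>n\<in>{1..N}-{d k}. a n (k, d k) + a n (?o n)) = (\<Sum>n\<in>{1..N}-{d k}. b n (k, d k) + b n (?o n))"
        using cross[OF k] by (intro sum.cong) auto
      then have others: "(\<Sum>n\<in>{1..N}-{d k}. a n (?o n)) = (\<Sum>n\<in>{1..N}-{d k}. b n (?o n))"
        by (simp only: sum.distrib cached[OF dk] add_left_cancel)
      have "a (d k) (?o (d k)) = b (d k) (?o (d k))"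
        using total by (simp only: sum.remove[OF finite_atLeastAtMost dk] others add_right_cancel)
      then show ?thesis
        using cross[OF j dk jk] True by (metis add_right_cancel)
    qed
  qed
qed

lemma subfile_scheme_leave_one_out:
  assumes N: "2 \<le> N" "N \<le> K"
  shows "subfile_scheme N K (K * (N - 1)) N ((N - 1) * (N * (K - 1) - 1))
    (\<lambda>n. {1..K} \<times> ({1..N} - {n})) (leave_one_out_cache N) (leave_one_out_cast N K)"
  unfolding subfile_scheme_def
proof (intro conjI ballI allI impI)
  fix k
  show "finite (leave_one_out_cache N k)"
    by (simp add: leave_one_out_cache_def)
  show "card (leave_one_out_cache N k) \<le> N"
    unfolding leave_one_out_cache_def using card_image_le[of "{1..N}"] by simp
next
  fix d assume d: "d \<in> demands N K"
  show "finite (leave_one_out_cast N K d)"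
    unfolding leave_one_out_cast_def by (intro finite_UnI finite_imageI) auto
  show "card (leave_one_out_cast N K d) \<le> (N - 1) * (N * (K - 1) - 1)"
    by (rule card_leave_one_out_cast[OF N d])
next
  fix d k i and a b :: "(nat \<times> nat) subfiles"
  assume "d \<in> demands N K" "k \<in> {1..K}" "\<forall>f\<in>leave_one_out_cache N k. f a = f b"
    "\<forall>f\<in>leave_one_out_cast N K d. f a = f b" "i \<in> {1..K} \<times> ({1..N} - {d k})"
  then show "a (d k) i = b (d k) i"
    using leave_one_out_decodes[OF N(1)] by blast
qed auto

section \<open>Memory sharing between the corner points\<close>

lemma sum_if_less:
  fixes u v :: "'a :: semiring_1"
  shows "(\<Sum>c<x + y. if c < x then u else v) = of_nat x * u + of_nat y * v"
proof -
  have "{..<x + y} = {..<x} \<union> {x..<x + y}" "{..<x} \<inter> {x..<x + y} = {}"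
    by auto
  then show ?thesis
    by (simp add: sum.union_disjoint)
qed

lemma achievable_rational:
  assumes N: "2 \<le> N" "N \<le> K" and M: "M \<in> \<rat>"
    and range: "1 / real K \<le> M" "M \<le> real N / (real K * (real N - 1))"
  shows "achievable N K M ((real K * real N - 1) / real K - (real N - 1) * M)"
proof -
  \<comment> \<open>The corner points differ by \<open>1 / (K (N - 1))\<close> in cache size, so
    \<open>t\<close> is the relative position of \<open>M\<close> between them.\<close>
  define t where "t = (M - 1 / real K) * (real K * (real N - 1))"
  have pos: "0 < real K" "0 < real N - 1"
    using N by auto
  have "t \<in> \<rat>"
    using M by (simp add: t_def)
  moreover have t0: "0 \<le> t"
    using range(1) pos by (simp add: t_def)
  ultimately obtain p q :: nat where q: "q \<noteq> 0" and pq: "t = real p / real q"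
    using Rats_abs_nat_div_natE[of t] by (metis abs_of_nonneg)
  have "M * (real K * (real N - 1)) \<le> real N"
    using range(2) pos by (simp add: pos_le_divide_eq)
  then have "t \<le> 1"
    using pos by (simp add: t_def left_diff_distrib)
  then have "p \<le> q"
    using q by (simp add: pq divide_le_eq)
  \<comment> \<open>A copy of the first scheme has \<open>K\<close> bits per file, a copy of the
    second \<open>K * (N - 1)\<close>. With \<open>x\<close> copies of the first and
    \<open>p\<close> of the second, the second takes up the fraction \<open>p / q = t\<close> of
    each file.\<close>
  define x where "x = (N - 1) * (q - p)"
  have N1: "real (N - 1) = real N - 1"
    using N by (simp add: of_nat_diff)
  have x: "real x = (real N - 1) * (real q - real p)"
    using N \<open>p \<le> q\<close> by (simp add: x_def of_nat_diff)
  have M_eq: "M * (real K * (real N - 1)) * real q = (real N - 1) * real q + real p"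
  proof -
    have t_eq: "t = M * (real K * (real N - 1)) - (real N - 1)"
      using pos by (simp add: t_def left_diff_distrib)
    have "t * real q = real p"
      using pq q by simp
    then have "(M * (real K * (real N - 1)) - (real N - 1)) * real q = real p"
      by (simp only: t_eq)
    then show ?thesis
      by (simp add: algebra_simps)
  qed
  have "subfile_mixture N K {..<x + p} (\<lambda>i. if i < x then K else K * (N - 1)) (\<lambda>i. if i < x then 1 else N)
      (\<lambda>i. if i < x then N * (K - 1) else (N - 1) * (N * (K - 1) - 1))
      (\<lambda>i. if i < x then (\<lambda>_. {1..K} \<times> {0}) else (\<lambda>n. {1..K} \<times> ({1..N} - {n})))
      (\<lambda>i. if i < x then sum_cache N else leave_one_out_cache N)
      (\<lambda>i. if i < x then sum_cast N K else leave_one_out_cast N K)"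
  proof
    show "0 < (\<Sum>i<x + p. if i < x then K else K * (N - 1))"
      using N q \<open>p \<le> q\<close> by (cases "p = 0") (simp_all add: sum_if_less x_def)
  qed (use N subfile_scheme_sum[of N K] subfile_scheme_leave_one_out[of N K] in auto)
  moreover have "real (\<Sum>i<x + p. if i < x then K else K * (N - 1)) = real K * (real N - 1) * real q"
    unfolding sum_if_less
    by (simp only: of_nat_add of_nat_mult of_nat_id x N1) (simp add: algebra_simps)
  moreover have "real (\<Sum>i<x + p. if i < x then 1 else N) = M * (real K * (real N - 1) * real q)"
    using M_eq unfolding sum_if_less by (simp add: x algebra_simps)
  moreover have "real (\<Sum>i<x + p. if i < x then N * (K - 1) else (N - 1) * (N * (K - 1) - 1)) =
      ((real K * real N - 1) / real K - (real N - 1) * M) * (real K * (real N - 1) * real q)"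
  proof -
    have "1 \<le> N * (K - 1)"
      using N by (cases K) auto
    then have b: "real (N * (K - 1) - 1) = real N * (real K - 1) - 1" and K1: "real (K - 1) = real K - 1"
      using N by (simp_all add: of_nat_diff)
    have "real (\<Sum>i<x + p. if i < x then N * (K - 1) else (N - 1) * (N * (K - 1) - 1)) =
        (real N - 1) * ((real K * real N - 1) * real q - ((real N - 1) * real q + real p))"
      unfolding sum_if_less
      by (simp only: of_nat_add of_nat_mult of_nat_id x N1 K1 b) (simp add: algebra_simps)
    also have "\<dots> = (real N - 1) * ((real K * real N - 1) * real q - M * (real K * (real N - 1)) * real q)"
      by (simp only: M_eq)
    also have "\<dots> = ((real K * real N - 1) / real K - (real N - 1) * M) * (real K * (real N - 1) * real q)"
      using pos by (simp add: field_simps)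
    finally show ?thesis .
  qed
  ultimately show ?thesis
    using subfile_mixture.achievable_mixture N by fastforce
qed

section \<open>The exact tradeoff\<close>

lemma achievable_mono:
  assumes "achievable N K M R" "M \<le> M'"
  shows "achievable N K M' R"
  using assms unfolding achievable_def by (meson order_trans)

lemma achievable_lower_bound:
  assumes N: "2 \<le> N" "N \<le> K" "K + 1 \<le> 2 * N" and ach: "achievable N K M R"
  shows "(real K * real N - 1) / real K - (real N - 1) * M \<le> R"
proof -
  obtain F m r Z X where s: "symmetric_caching_scheme N K F m r Z X"
    and M: "\<forall>k\<in>{1..K}. real (m k) / real F \<le> M" and R: "scheme_rate N K F r \<le> R"
    using ach unfolding achievable_def by blast
  interpret symmetric_caching_scheme N K F m r Z X
    by (rule s)
  have "real (r d) / real F \<le> R" if "d \<in> demands N K" for d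
  proof -
    have "real (r d) / real F \<le> scheme_rate N K F r"
      unfolding scheme_rate_def using that finite_demands by (intro Max_ge) auto
    then show ?thesis
      using R by linarith
  qed
  then show ?thesis
    using M by (intro rate_lower_bound[OF N]) auto
qed

theorem theorem3:
  fixes N K :: nat and M :: real
  assumes "1 \<le> N" and "N \<le> K"
    and "\<lceil>(real K + 1) / 2\<rceil> \<le> int N"
    and "M \<in> {1 / real K .. real N / (real K * (real N - 1))}"
  shows "optimal_rate N K M = (real K * real N - 1) / real K - (real N - 1) * M \<and>
    (M \<in> \<rat> \<longrightarrow> achievable N K M ((real K * real N - 1) / real K - (real N - 1) * M))"
proof
  let ?R = "\<lambda>M. (real K * real N - 1) / real K - (real N - 1) * M"
  have half: "K + 1 \<le> 2 * N"
    using assms(3) by (simp add: ceiling_le_iff)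
  have range: "1 / real K \<le> M" "M \<le> real N / (real K * (real N - 1))"
    using assms(4) by auto
  \<comment> \<open>For \<open>N = 1\<close> the upper end of the interval is a division by zero,
    which is 0, so the interval is empty.\<close>
  have N: "2 \<le> N"
  proof (rule ccontr)
    assume "\<not> 2 \<le> N"
    then have "N = 1"
      using assms(1) by simp
    moreover have "0 < 1 / real K"
      using assms(1,2) by simp
    moreover have "M \<le> 0"
      using range(2) \<open>N = 1\<close> by simp
    ultimately show False
      using range(1) by linarith
  qed
  show rational: "M \<in> \<rat> \<longrightarrow> achievable N K M (?R M)"
    using achievable_rational[OF N assms(2) _ range] by blast
  have below: "?R M \<le> R" if "achievable N K M R" for R
    by (rule achievable_lower_bound[OF N assms(2) half that])
  \<comment> \<open>A rational cache size slightly below \<open>M\<close> is used and the remaining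
    memory is left idle. At the left end there is no room below, but that point is itself
    rational.\<close>
  have close: "\<exists>R. achievable N K M R \<and> R < y" if y: "?R M < y" for y
  proof (cases "M = 1 / real K")
    case True
    then show ?thesis
      using rational y by auto
  next
    case False
    \<comment> \<open>The line has slope \<open>-(N - 1)\<close>, so lowering the cache size by less
      than \<open>\<epsilon>\<close> keeps its value below \<open>y\<close>.\<close>
    define \<epsilon> where "\<epsilon> = (y - ?R M) / (real N - 1)"
    have "0 < \<epsilon>"
      using N y by (simp add: \<epsilon>_def)
    then have "max (1 / real K) (M - \<epsilon>) < M"
      using False range by auto
    then obtain M' where M': "M' \<in> \<rat>" "max (1 / real K) (M - \<epsilon>) < M'" "M' < M"
      using Rats_dense_in_real by blast
    have "achievable N K M' (?R M')"
      using M' range by (intro achievable_rational N assms(2)) auto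
    then have ach: "achievable N K M (?R M')"
      using M' by (auto intro: achievable_mono)
    have "(real N - 1) * (M - M') < (real N - 1) * \<epsilon>"
      using M' N by (intro mult_strict_left_mono) auto
    moreover have "(real N - 1) * \<epsilon> = y - ?R M"
      using N by (simp add: \<epsilon>_def)
    ultimately have "?R M' < y"
      unfolding right_diff_distrib[of _ M M'] by linarith
    then show ?thesis
      using ach by blast
  qed
  show "optimal_rate N K M = ?R M"
    unfolding optimal_rate_def
  proof (rule cInf_eq_non_empty)
    show "{R. achievable N K M R} \<noteq> {}"
      using close[of "?R M + 1"] by auto
    show "y \<le> ?R M" if "\<And>R. R \<in> {R. achievable N K M R} \<Longrightarrow> y \<le> R" for y
    proof (rule ccontr)
      assume "\<not> y \<le> ?R M"
      then obtain R where "achievable N K M R" "R < y"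
        using close[of y] by auto
      then show False
        using that[of R] by simp
    qed
  qed (use below in auto)
qed

end
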